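(* Let $n\geq 2$ be an integer and $C_n$ a primitive multiple curve of multiplicity $n$ whose associated reduced curve $C$ is projective (smooth, irreducible, over $\mathbb{C}$). For every $\phi\in\mathrm{Aut}^0_C(C_n)$ there exists a unique $D\in H^0(C_{n-1},\mathcal{D}_{n-1}\otimes\mathcal{I}_C)$ such that $\phi=\chi_D$.
   Context: A primitive multiple curve $C_n$ of multiplicity $n$ with associated reduced curve $C$ is a scheme obtained by gluing schemes $U_i\times\mathrm{spec}(\mathbb{C}[t]/(t^n))$, $(U_i)$ an open cover of $C$, by means of automorphisms over $U_{ij}$ inducing the identity on $U_{ij}$ and satisfying the cocycle relations. $\mathcal{I}_C$ is the ideal sheaf of $C$ in $C_n$, $C_{k}\subset C_n$ is the subscheme with ideal sheaf $\mathcal{I}_C^{k}$, $\mathcal{O}_n=\mathcal{O}_{C_n}$, and $L=\mathcal{I}_C/\mathcal{I}_C^2$. $\mathrm{Aut}_C(C_n)$ is the group of automorphisms of $C_n$ inducing the identity on $C$, and $\mathrm{Aut}_C^0(C_n)$ is the subgroup of automorphisms inducing the identity on $L$, i.e. the kernel of the morphism $\mathrm{Aut}_C(C_n)\to\mathbb{C}^*$ sending an automorphism to the induced automorphism (homothety) of $L$. $\mathcal{D}_{n-1}=(\Omega_{C_{n-1}})^*$ is the sheaf of derivations of $C_{n-1}$ ($\mathcal{D}_1=T_C$), and $\mathcal{D}_{n-1}\otimes\mathcal{I}_C$ is identified with the subsheaf $\mathcal{I}_C\mathcal{D}_n$ of $\mathcal{D}_n=(\Omega_{C_n})^*$: its local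 sections are the derivations $D$ of $\mathcal{O}_n$ such that $\mathrm{im}(D)\subset\mathcal{I}_C$ and $D(\mathcal{I}_C)\subset\mathcal{I}_C^2$ (in local coordinates $D=at\frac{\partial}{\partial x}+bt^2\frac{\partial}{\partial t}$). For $D\in H^0(C_{n-1},\mathcal{D}_{n-1}\otimes\mathcal{I}_C)$, $\chi_D\in\mathrm{Aut}_C^0(C_n)$ is defined by: for every open subset $U$ of $C_n$ and $\lambda\in\mathcal{O}_n(U)$, $$\chi_D(\lambda)=\sum_{k\geq 0}\frac{1}{k!}D^k(\lambda).$$ *)

theory Defs
  imports "HOL-Analysis.Abstract_Topology" "HOL-Algebra.Algebra" "HOL-Algebra.Algebraic_Closure_Type"
    "HOL-Library.Poly_Mapping"
begin

no_notation Polynomials.var (\<open>X\<index>\<close>)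

section \<open>Ringed spaces over the complex numbers\<close>

text \<open>A space with a presheaf of \<open>\<complex>\<close>-algebras: \<open>sec X U\<close> is the ring of sections over \<open>U\<close>,
  \<open>res X U V\<close> the restriction from \<open>U\<close> to \<open>V\<close>, and \<open>scal X U\<close> the structure map
  from \<open>\<complex>\<close> to the sections over \<open>U\<close>. Only open sets \<open>U\<close>, \<open>V\<close> are meaningful.\<close>

record ('p, 's) cspace =
  top_of :: "'p topology"
  sec :: "'p set \<Rightarrow> 's ring"
  res :: "'p set \<Rightarrow> 'p set \<Rightarrow> 's \<Rightarrow> 's"
  scal :: "'p set \<Rightarrow> complex \<Rightarrow> 's"

abbreviation opens :: "('p, 's) cspace \<Rightarrow> 'p set set" where
  "opens X \<equiv> {U. openin (top_of X) U}"

abbreviation points :: "('p, 's) cspace \<Rightarrow> 'p set" where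
  "points X \<equiv> topspace (top_of X)"

definition presheaf :: "('p, 's) cspace \<Rightarrow> bool" where
  "presheaf X \<longleftrightarrow>
     (\<forall>U\<in>opens X. cring (sec X U)) \<and>
     (\<forall>U\<in>opens X. \<forall>V\<in>opens X. V \<subseteq> U \<longrightarrow> res X U V \<in> ring_hom (sec X U) (sec X V)) \<and>
     (\<forall>U\<in>opens X. \<forall>s\<in>carrier (sec X U). res X U U s = s) \<and>
     (\<forall>U\<in>opens X. \<forall>V\<in>opens X. \<forall>W\<in>opens X. W \<subseteq> V \<and> V \<subseteq> U \<longrightarrow>
        (\<forall>s\<in>carrier (sec X U). res X V W (res X U V s) = res X U W s)) \<and>
     (\<forall>U\<in>opens X. scal X U \<in> ring_hom (ring_of_type_algebra :: complex ring) (sec X U)) \<and>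
     (\<forall>U\<in>opens X. \<forall>V\<in>opens X. V \<subseteq> U \<longrightarrow> (\<forall>c. res X U V (scal X U c) = scal X V c))"

definition ringed_space :: "('p, 's) cspace \<Rightarrow> bool" where
  "ringed_space X \<longleftrightarrow> presheaf X \<and>
     (\<forall>\<U>\<subseteq>opens X. \<forall>s\<in>carrier (sec X (\<Union>\<U>)). \<forall>t\<in>carrier (sec X (\<Union>\<U>)).
        (\<forall>V\<in>\<U>. res X (\<Union>\<U>) V s = res X (\<Union>\<U>) V t) \<longrightarrow> s = t) \<and>
     (\<forall>\<U>\<subseteq>opens X. \<forall>s.
        (\<forall>V\<in>\<U>. s V \<in> carrier (sec X V)) \<and>
        (\<forall>V\<in>\<U>. \<forall>W\<in>\<U>. res X V (V \<inter> W) (s V) = res X W (V \<inter> W) (s W)) \<longrightarrow>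
        (\<exists>t\<in>carrier (sec X (\<Union>\<U>)). \<forall>V\<in>\<U>. res X (\<Union>\<U>) V t = s V))"

definition restrict_space :: "('p, 's) cspace \<Rightarrow> 'p set \<Rightarrow> ('p, 's) cspace" where
  "restrict_space X U = X\<lparr>top_of := subtopology (top_of X) U\<rparr>"

subsection \<open>Stalks\<close>

definition germ :: "('p, 's) cspace \<Rightarrow> 'p \<Rightarrow> 'p set \<Rightarrow> 's \<Rightarrow> ('p set \<times> 's) set" where
  "germ X x U s = {(V, t). V \<in> opens X \<and> x \<in> V \<and> t \<in> carrier (sec X V) \<and>
     (\<exists>W\<in>opens X. x \<in> W \<and> W \<subseteq> U \<inter> V \<and> res X U W s = res X V W t)}"

definition stalk :: "('p, 's) cspace \<Rightarrow> 'p \<Rightarrow> ('p set \<times> 's) set ring" where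
  "stalk X x =
     \<lparr>carrier = {germ X x U s | U s. U \<in> opens X \<and> x \<in> U \<and> s \<in> carrier (sec X U)},
      monoid.mult = (\<lambda>A B. \<Union>(U, s)\<in>A. \<Union>(V, t)\<in>B.
        germ X x (U \<inter> V) (res X U (U \<inter> V) s \<otimes>\<^bsub>sec X (U \<inter> V)\<^esub> res X V (U \<inter> V) t)),
      one = germ X x (points X) \<one>\<^bsub>sec X (points X)\<^esub>,
      ring.zero = germ X x (points X) \<zero>\<^bsub>sec X (points X)\<^esub>,
      add = (\<lambda>A B. \<Union>(U, s)\<in>A. \<Union>(V, t)\<in>B.
        germ X x (U \<inter> V) (res X U (U \<inter> V) s \<oplus>\<^bsub>sec X (U \<inter> V)\<^esub> res X V (U \<inter> V) t))\<rparr>"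

definition local_ring :: "('a, 'm) ring_scheme \<Rightarrow> bool" where
  "local_ring R \<longleftrightarrow> cring R \<and> (\<exists>!m. maximalideal m R)"

subsection \<open>Morphisms\<close>

text \<open>A morphism from \<open>X\<close> to \<open>Y\<close> is a pair \<open>(f, \<phi>)\<close> of a map of points and a family \<open>\<phi> V\<close>
  of maps from the sections of \<open>Y\<close> over \<open>V\<close> to the sections of \<open>X\<close> over the preimage of \<open>V\<close>.\<close>

type_synonym ('p, 's, 'q, 't) mor = "('p \<Rightarrow> 'q) \<times> ('q set \<Rightarrow> 't \<Rightarrow> 's)"

definition pre :: "('p, 's) cspace \<Rightarrow> ('p \<Rightarrow> 'q) \<Rightarrow> 'q set \<Rightarrow> 'p set" where
  "pre X f V = {x \<in> points X. f x \<in> V}"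

definition ringed_morphism ::
  "('p, 's) cspace \<Rightarrow> ('q, 't) cspace \<Rightarrow> ('p, 's, 'q, 't) mor \<Rightarrow> bool" where
  "ringed_morphism X Y F \<longleftrightarrow> (case F of (f, \<phi>) \<Rightarrow>
     continuous_map (top_of X) (top_of Y) f \<and>
     (\<forall>V\<in>opens Y. \<phi> V \<in> ring_hom (sec Y V) (sec X (pre X f V))) \<and>
     (\<forall>V\<in>opens Y. \<forall>c. \<phi> V (scal Y V c) = scal X (pre X f V) c) \<and>
     (\<forall>V\<in>opens Y. \<forall>W\<in>opens Y. W \<subseteq> V \<longrightarrow> (\<forall>s\<in>carrier (sec Y V).
        \<phi> W (res Y V W s) = res X (pre X f V) (pre X f W) (\<phi> V s))))"

text \<open>Morphisms of locally ringed spaces. The last clause says that the maps of local rings are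
  local: if the image of the germ of \<open>s\<close> at \<open>f x\<close> is a unit, then so is the germ of \<open>s\<close>.\<close>

definition morphism ::
  "('p, 's) cspace \<Rightarrow> ('q, 't) cspace \<Rightarrow> ('p, 's, 'q, 't) mor \<Rightarrow> bool" where
  "morphism X Y F \<longleftrightarrow> ringed_morphism X Y F \<and> (case F of (f, \<phi>) \<Rightarrow>
     (\<forall>x\<in>points X. \<forall>V\<in>opens Y. f x \<in> V \<longrightarrow> (\<forall>s\<in>carrier (sec Y V).
        germ X x (pre X f V) (\<phi> V s) \<in> Units (stalk X x) \<longrightarrow>
        germ Y (f x) V s \<in> Units (stalk Y (f x)))))"

definition isomorphism ::
  "('p, 's) cspace \<Rightarrow> ('q, 't) cspace \<Rightarrow> ('p, 's, 'q, 't) mor \<Rightarrow> bool" where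
  "isomorphism X Y F \<longleftrightarrow> ringed_morphism X Y F \<and> (case F of (f, \<phi>) \<Rightarrow>
     homeomorphic_map (top_of X) (top_of Y) f \<and>
     (\<forall>V\<in>opens Y. \<phi> V \<in> ring_iso (sec Y V) (sec X (pre X f V))))"

definition closed_immersion ::
  "('p, 's) cspace \<Rightarrow> ('q, 't) cspace \<Rightarrow> ('p, 's, 'q, 't) mor \<Rightarrow> bool" where
  "closed_immersion X Y F \<longleftrightarrow> morphism X Y F \<and> (case F of (f, \<phi>) \<Rightarrow>
     embedding_map (top_of X) (top_of Y) f \<and> closedin (top_of Y) (f ` points X) \<and>
     (\<forall>V\<in>opens Y. \<forall>t\<in>carrier (sec X (pre X f V)). \<forall>y\<in>V. \<exists>W\<in>opens Y. y \<in> W \<and> W \<subseteq> V \<and>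
        (\<exists>s\<in>carrier (sec Y W). \<phi> W s = res X (pre X f V) (pre X f W) t)))"

definition mor_comp ::
  "('q, 't) cspace \<Rightarrow> ('q, 't, 'r, 'u) mor \<Rightarrow> ('p, 's, 'q, 't) mor \<Rightarrow> ('p, 's, 'r, 'u) mor" where
  "mor_comp Y G F = (case G of (g, \<psi>) \<Rightarrow> case F of (f, \<phi>) \<Rightarrow>
     (g \<circ> f, \<lambda>V s. \<phi> (pre Y g V) (\<psi> V s)))"

text \<open>Equality of morphisms, disregarding the values outside the spaces and rings of sections.\<close>

definition mor_eq ::
  "('p, 's) cspace \<Rightarrow> ('q, 't) cspace \<Rightarrow> ('p, 's, 'q, 't) mor \<Rightarrow> ('p, 's, 'q, 't) mor \<Rightarrow> bool" where
  "mor_eq X Y F G \<longleftrightarrow> (case F of (f, \<phi>) \<Rightarrow> case G of (g, \<psi>) \<Rightarrow>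
     (\<forall>x\<in>points X. f x = g x) \<and>
     (\<forall>V\<in>opens Y. \<forall>s\<in>carrier (sec Y V). \<phi> V s = \<psi> V s))"

section \<open>Schemes\<close>

subsection \<open>Sheaves of fractions\<close>

text \<open>\<open>frac R T a f\<close> is the class of \<open>a/f\<close> in the localization of \<open>R\<close> at the multiplicative set \<open>T\<close>;
  sum and product of classes are formed by means of arbitrary representatives.\<close>

definition frac :: "'a ring \<Rightarrow> 'a set \<Rightarrow> 'a \<Rightarrow> 'a \<Rightarrow> ('a \<times> 'a) set" where
  "frac R T a f = {(b, g). b \<in> carrier R \<and> g \<in> T \<and>
     (\<exists>h\<in>T. h \<otimes>\<^bsub>R\<^esub> (a \<otimes>\<^bsub>R\<^esub> g \<ominus>\<^bsub>R\<^esub> b \<otimes>\<^bsub>R\<^esub> f) = \<zero>\<^bsub>R\<^esub>)}"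

definition frac_add :: "'a ring \<Rightarrow> 'a set \<Rightarrow> ('a \<times> 'a) set \<Rightarrow> ('a \<times> 'a) set \<Rightarrow> ('a \<times> 'a) set" where
  "frac_add R T A B = (\<Union>(a, f)\<in>A. \<Union>(b, g)\<in>B.
     frac R T (a \<otimes>\<^bsub>R\<^esub> g \<oplus>\<^bsub>R\<^esub> b \<otimes>\<^bsub>R\<^esub> f) (f \<otimes>\<^bsub>R\<^esub> g))"

definition frac_mult :: "'a ring \<Rightarrow> 'a set \<Rightarrow> ('a \<times> 'a) set \<Rightarrow> ('a \<times> 'a) set \<Rightarrow> ('a \<times> 'a) set" where
  "frac_mult R T A B = (\<Union>(a, f)\<in>A. \<Union>(b, g)\<in>B. frac R T (a \<otimes>\<^bsub>R\<^esub> b) (f \<otimes>\<^bsub>R\<^esub> g))"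

text \<open>The common shape of the structure sheaves of Spec and Proj: the sections over \<open>V\<close> are the
  functions with value at \<open>p\<close> in the localization at \<open>T p\<close> which locally are given by a fraction
  \<open>a/f\<close> with \<open>(a, f) \<in> Q\<close>. The map \<open>\<sigma>\<close> gives the algebra structure of \<open>R\<close>.\<close>

definition frac_space ::
  "'a ring \<Rightarrow> (complex \<Rightarrow> 'a) \<Rightarrow> 'a set topology \<Rightarrow> ('a set \<Rightarrow> 'a set) \<Rightarrow> ('a \<times> 'a) set \<Rightarrow>
   ('a set, 'a set \<Rightarrow> ('a \<times> 'a) set) cspace" where
  "frac_space R \<sigma> Z T Q =
     \<lparr>top_of = Z,
      sec = (\<lambda>V.
        \<lparr>carrier = {s \<in> extensional V. \<forall>p\<in>V. \<exists>W. openin Z W \<and> p \<in> W \<and> W \<subseteq> V \<and>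
            (\<exists>(a, f)\<in>Q. \<forall>q\<in>W. f \<in> T q \<and> s q = frac R (T q) a f)},
         monoid.mult = (\<lambda>s t. \<lambda>p\<in>V. frac_mult R (T p) (s p) (t p)),
         one = (\<lambda>p\<in>V. frac R (T p) \<one>\<^bsub>R\<^esub> \<one>\<^bsub>R\<^esub>),
         ring.zero = (\<lambda>p\<in>V. frac R (T p) \<zero>\<^bsub>R\<^esub> \<one>\<^bsub>R\<^esub>),
         add = (\<lambda>s t. \<lambda>p\<in>V. frac_add R (T p) (s p) (t p))\<rparr>),
      res = (\<lambda>V W s. restrict s W),
      scal = (\<lambda>V c. \<lambda>p\<in>V. frac R (T p) (\<sigma> c) \<one>\<^bsub>R\<^esub>)\<rparr>"

subsection \<open>Affine schemes and schemes\<close>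

definition zariski :: "'a ring \<Rightarrow> 'a set topology" where
  "zariski R = topology_generated_by {{p. primeideal p R \<and> f \<notin> p} | f. f \<in> carrier R}"

definition Spec ::
  "'a ring \<Rightarrow> (complex \<Rightarrow> 'a) \<Rightarrow> ('a set, 'a set \<Rightarrow> ('a \<times> 'a) set) cspace" where
  "Spec R \<sigma> = frac_space R \<sigma> (zariski R) (\<lambda>p. carrier R - p) (carrier R \<times> carrier R)"

text \<open>A space isomorphic to the spectrum of some algebra is isomorphic to the spectrum of its
  algebra of global sections; this avoids a quantification over the type of the algebra.
  (A space which is locally affine is automatically locally ringed.)\<close>

definition affine_scheme :: "('p, 's) cspace \<Rightarrow> bool" where
  "affine_scheme X \<longleftrightarrow> ringed_space X \<and>
     (\<exists>F. isomorphism X (Spec (sec X (points X)) (scal X (points X))) F)"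

definition scheme_over_complex :: "('p, 's) cspace \<Rightarrow> bool" where
  "scheme_over_complex X \<longleftrightarrow> ringed_space X \<and>
     (\<forall>x\<in>points X. \<exists>U\<in>opens X. x \<in> U \<and> affine_scheme (restrict_space X U))"

subsection \<open>Projective space\<close>

text \<open>A monomial is the finitely supported function which maps the index of a variable to its
  exponent.\<close>

type_synonym cpoly = "(nat \<Rightarrow>\<^sub>0 nat) \<Rightarrow>\<^sub>0 complex"

definition cpoly_ring :: "nat \<Rightarrow> cpoly ring" where
  "cpoly_ring N = \<lparr>carrier = {p. \<forall>m\<in>Poly_Mapping.keys p. Poly_Mapping.keys m \<subseteq> {..N}},
     monoid.mult = (*), one = 1, ring.zero = 0, add = (+)\<rparr>"

definition forms :: "nat \<Rightarrow> nat \<Rightarrow> cpoly set" where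
  "forms N d = {p \<in> carrier (cpoly_ring N).
     \<forall>m\<in>Poly_Mapping.keys p. (\<Sum>i\<in>Poly_Mapping.keys m. Poly_Mapping.lookup m i) = d}"

definition proj_points :: "nat \<Rightarrow> cpoly set set" where
  "proj_points N = {p. primeideal p (cpoly_ring N) \<and>
     p = genideal (cpoly_ring N) (p \<inter> (\<Union>d. forms N d)) \<and>
     \<not> (\<Union>d\<in>{1..}. forms N d) \<subseteq> p}"

definition proj_top :: "nat \<Rightarrow> cpoly set topology" where
  "proj_top N = topology_generated_by {{p \<in> proj_points N. f \<notin> p} | f d. d \<ge> 1 \<and> f \<in> forms N d}"

definition Proj :: "nat \<Rightarrow> (cpoly set, cpoly set \<Rightarrow> (cpoly \<times> cpoly) set) cspace" where
  "Proj N = frac_space (cpoly_ring N) (Poly_Mapping.single 0) (proj_top N)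
     (\<lambda>p. (\<Union>d. forms N d) - p) (\<Union>d. forms N d \<times> forms N d)"

definition projective :: "('p, 's) cspace \<Rightarrow> bool" where
  "projective X \<longleftrightarrow> (\<exists>N F. closed_immersion X (Proj N) F)"

subsection \<open>Smooth projective curves\<close>

text \<open>\<open>chain_dim \<F> d\<close>: the supremum of the lengths of the strictly increasing finite chains of
  members of \<open>\<F>\<close> is \<open>d\<close>.\<close>

definition has_chain :: "'a set set \<Rightarrow> nat \<Rightarrow> bool" where
  "has_chain \<F> d \<longleftrightarrow> (\<exists>Z. (\<forall>i\<le>d. Z i \<in> \<F>) \<and> (\<forall>i<d. Z i \<subset> Z (Suc i)))"

definition chain_dim :: "'a set set \<Rightarrow> nat \<Rightarrow> bool" where
  "chain_dim \<F> d \<longleftrightarrow> has_chain \<F> d \<and> \<not> has_chain \<F> (Suc d)"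

definition irreducible_in :: "'p topology \<Rightarrow> 'p set \<Rightarrow> bool" where
  "irreducible_in X Z \<longleftrightarrow> Z \<subseteq> topspace X \<and> Z \<noteq> {} \<and>
     (\<forall>A B. closedin X A \<and> closedin X B \<and> Z \<subseteq> A \<union> B \<longrightarrow> Z \<subseteq> A \<or> Z \<subseteq> B)"

definition top_dim :: "'p topology \<Rightarrow> nat \<Rightarrow> bool" where
  "top_dim X d \<longleftrightarrow> chain_dim {Z. closedin X Z \<and> irreducible_in X Z} d"

definition regular_local_ring :: "('a, 'm) ring_scheme \<Rightarrow> bool" where
  "regular_local_ring R \<longleftrightarrow> local_ring R \<and> noetherian_ring R \<and>
     (\<exists>d. chain_dim {p. primeideal p R} d \<and>
       (\<exists>A\<subseteq>carrier R. finite A \<and> card A = d \<and> maximalideal (genideal R A) R))"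

text \<open>Over the complex numbers smoothness means that all the local rings are regular.\<close>

definition smooth_projective_curve :: "('p, 's) cspace \<Rightarrow> bool" where
  "smooth_projective_curve C \<longleftrightarrow> scheme_over_complex C \<and>
     irreducible_in (top_of C) (points C) \<and>
     top_dim (top_of C) 1 \<and>
     (\<forall>x\<in>points C. regular_local_ring (stalk C x)) \<and>
     projective C"

section \<open>Primitive multiple curves\<close>

text \<open>The product of \<open>X\<close> with the spectrum of \<open>\<complex>[t]/(t\<^sup>n)\<close>: the same topological space, and over
  \<open>U\<close> the truncated polynomials \<open>\<Sum>k<n. a k * t^k\<close> with coefficients in the sections of \<open>X\<close>.\<close>

definition trunc_poly_ring :: "nat \<Rightarrow> 's ring \<Rightarrow> (nat \<Rightarrow> 's) ring" where
  "trunc_poly_ring n R =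
     \<lparr>carrier = {a. (\<forall>k. a k \<in> carrier R) \<and> (\<forall>k\<ge>n. a k = \<zero>\<^bsub>R\<^esub>)},
      monoid.mult = (\<lambda>a b k. if k < n then \<Oplus>\<^bsub>R\<^esub>i\<in>{..k}. a i \<otimes>\<^bsub>R\<^esub> b (k - i) else \<zero>\<^bsub>R\<^esub>),
      one = (\<lambda>k. if k = 0 \<and> k < n then \<one>\<^bsub>R\<^esub> else \<zero>\<^bsub>R\<^esub>),
      ring.zero = (\<lambda>k. \<zero>\<^bsub>R\<^esub>),
      add = (\<lambda>a b k. a k \<oplus>\<^bsub>R\<^esub> b k)\<rparr>"

definition thicken :: "nat \<Rightarrow> ('p, 's) cspace \<Rightarrow> ('p, nat \<Rightarrow> 's) cspace" where
  "thicken n X =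
     \<lparr>top_of = top_of X,
      sec = (\<lambda>U. trunc_poly_ring n (sec X U)),
      res = (\<lambda>U V a k. res X U V (a k)),
      scal = (\<lambda>U c k. if k = 0 \<and> k < n then scal X U c else \<zero>\<^bsub>sec X U\<^esub>)\<rparr>"

text \<open>\<open>gluing n C \<U> \<delta>\<close>: for the open cover \<open>\<U>\<close> of \<open>C\<close>, the \<open>\<delta> U V\<close> (between sheaves of algebras)
  are automorphisms of the thickening of \<open>U \<inter> V\<close> which induce the identity on \<open>U \<inter> V\<close>
  (so in particular are the identity on points) and satisfy the cocycle relations.\<close>

definition gluing ::
  "nat \<Rightarrow> ('p, 's) cspace \<Rightarrow> 'p set set \<Rightarrow>
   ('p set \<Rightarrow> 'p set \<Rightarrow> 'p set \<Rightarrow> (nat \<Rightarrow> 's) \<Rightarrow> (nat \<Rightarrow> 's)) \<Rightarrow> bool" where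
  "gluing n C \<U> \<delta> \<longleftrightarrow> \<U> \<subseteq> opens C \<and> \<Union>\<U> = points C \<and>
     (\<forall>U\<in>\<U>. \<forall>V\<in>\<U>.
        isomorphism (restrict_space (thicken n C) (U \<inter> V)) (restrict_space (thicken n C) (U \<inter> V))
          (id, \<delta> U V) \<and>
        (\<forall>W\<in>opens C. W \<subseteq> U \<inter> V \<longrightarrow> (\<forall>a\<in>carrier (sec (thicken n C) W). \<delta> U V W a 0 = a 0))) \<and>
     (\<forall>U\<in>\<U>. \<forall>V\<in>\<U>. \<forall>T\<in>\<U>. \<forall>W\<in>opens C. W \<subseteq> U \<inter> V \<inter> T \<longrightarrow>
        (\<forall>a\<in>carrier (sec (thicken n C) W). \<delta> V T W (\<delta> U V W a) = \<delta> U T W a))"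

text \<open>\<open>X\<close> is a primitive multiple curve of multiplicity \<open>n\<close> with associated reduced curve \<open>C\<close>:
  it is glued from thickenings of the members of an open cover of \<open>C\<close>. Since \<open>C\<close> and \<open>X\<close> have the
  same points, the closed immersion of \<open>C\<close> in \<open>X\<close> is the identity on points; \<open>\<pi>\<close> is the
  corresponding map from the sections of \<open>X\<close> to those of \<open>C\<close>, given in the charts by \<open>t = 0\<close>.\<close>

definition primitive_multiple_curve ::
  "nat \<Rightarrow> ('p, 's) cspace \<Rightarrow> ('p, 'r) cspace \<Rightarrow> ('p set \<Rightarrow> 'r \<Rightarrow> 's) \<Rightarrow> bool" where
  "primitive_multiple_curve n C X \<pi> \<longleftrightarrow>
     scheme_over_complex X \<and> top_of X = top_of C \<and> closed_immersion C X (id, \<pi>) \<and>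
     (\<exists>\<U> \<delta> \<psi>. gluing n C \<U> \<delta> \<and>
       (\<forall>U\<in>\<U>.
          isomorphism (restrict_space (thicken n C) U) (restrict_space X U) (id, \<psi> U) \<and>
          (\<forall>W\<in>opens C. W \<subseteq> U \<longrightarrow> (\<forall>s\<in>carrier (sec X W). \<psi> U W s 0 = \<pi> W s))) \<and>
       (\<forall>U\<in>\<U>. \<forall>V\<in>\<U>. \<forall>W\<in>opens C. W \<subseteq> U \<inter> V \<longrightarrow>
          (\<forall>s\<in>carrier (sec X W). \<delta> U V W (\<psi> U W s) = \<psi> V W s)))"

subsection \<open>The ideal sheaf of the reduced curve and its square\<close>

definition curve_ideal ::
  "('p, 's) cspace \<Rightarrow> ('p, 'r) cspace \<Rightarrow> ('p set \<Rightarrow> 'r \<Rightarrow> 's) \<Rightarrow> 'p set \<Rightarrow> 'r set" where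
  "curve_ideal C X \<pi> U = a_kernel (sec X U) (sec C U) (\<pi> U)"

text \<open>The product of ideal sheaves, i.e. the sheaf generated by the products of sections.\<close>

definition ideal_sheaf_prod ::
  "('p, 'r) cspace \<Rightarrow> ('p set \<Rightarrow> 'r set) \<Rightarrow> ('p set \<Rightarrow> 'r set) \<Rightarrow> 'p set \<Rightarrow> 'r set" where
  "ideal_sheaf_prod X I J U = {s \<in> carrier (sec X U).
     \<forall>x\<in>U. \<exists>W\<in>opens X. x \<in> W \<and> W \<subseteq> U \<and> res X U W s \<in> ideal_prod (sec X W) (I W) (J W)}"

definition curve_ideal_square ::
  "('p, 's) cspace \<Rightarrow> ('p, 'r) cspace \<Rightarrow> ('p set \<Rightarrow> 'r \<Rightarrow> 's) \<Rightarrow> 'p set \<Rightarrow> 'r set" where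
  "curve_ideal_square C X \<pi> = ideal_sheaf_prod X (curve_ideal C X \<pi>) (curve_ideal C X \<pi>)"

subsection \<open>Automorphisms\<close>

definition Aut_C ::
  "('p, 's) cspace \<Rightarrow> ('p, 'r) cspace \<Rightarrow> ('p set \<Rightarrow> 'r \<Rightarrow> 's) \<Rightarrow> ('p, 'r, 'p, 'r) mor set" where
  "Aut_C C X \<pi> = {F. isomorphism X X F \<and> mor_eq C X (mor_comp X F (id, \<pi>)) (id, \<pi>)}"

text \<open>Automorphisms inducing the identity on the quotient \<open>L\<close> of the ideal sheaf by its square:
  sections of the ideal sheaf and their images have the same class. This can be tested on sections
  since the square is a subsheaf.\<close>

definition Aut0_C ::
  "('p, 's) cspace \<Rightarrow> ('p, 'r) cspace \<Rightarrow> ('p set \<Rightarrow> 'r \<Rightarrow> 's) \<Rightarrow> ('p, 'r, 'p, 'r) mor set" where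
  "Aut0_C C X \<pi> = {F \<in> Aut_C C X \<pi>. \<forall>U\<in>opens X. \<forall>s\<in>curve_ideal C X \<pi> U.
     curve_ideal_square C X \<pi> U +>\<^bsub>sec X U\<^esub> snd F U s = curve_ideal_square C X \<pi> U +>\<^bsub>sec X U\<^esub> s}"

subsection \<open>Derivations\<close>

text \<open>The sections over \<open>U\<close> of the sheaf of \<open>\<complex>\<close>-linear derivations of the structure sheaf of \<open>X\<close>.
  The requirements of extensionality make equality of sections coincide with equality in HOL.\<close>

definition derivations :: "('p, 'r) cspace \<Rightarrow> 'p set \<Rightarrow> ('p set \<Rightarrow> 'r \<Rightarrow> 'r) set" where
  "derivations X U = {D \<in> extensional {V \<in> opens X. V \<subseteq> U}.
     (\<forall>V\<in>opens X. V \<subseteq> U \<longrightarrow>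
        D V \<in> carrier (sec X V) \<rightarrow>\<^sub>E carrier (sec X V) \<and>
        (\<forall>s\<in>carrier (sec X V). \<forall>t\<in>carrier (sec X V).
           D V (s \<oplus>\<^bsub>sec X V\<^esub> t) = D V s \<oplus>\<^bsub>sec X V\<^esub> D V t \<and>
           D V (s \<otimes>\<^bsub>sec X V\<^esub> t) = s \<otimes>\<^bsub>sec X V\<^esub> D V t \<oplus>\<^bsub>sec X V\<^esub> t \<otimes>\<^bsub>sec X V\<^esub> D V s) \<and>
        (\<forall>c. \<forall>s\<in>carrier (sec X V).
           D V (scal X V c \<otimes>\<^bsub>sec X V\<^esub> s) = scal X V c \<otimes>\<^bsub>sec X V\<^esub> D V s)) \<and>
     (\<forall>V\<in>opens X. \<forall>W\<in>opens X. W \<subseteq> V \<and> V \<subseteq> U \<longrightarrow>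
        (\<forall>s\<in>carrier (sec X V). D W (res X V W s) = res X V W (D V s)))}"

text \<open>The sections over \<open>U\<close> of the subsheaf of derivations mapping the structure sheaf into the
  ideal sheaf of \<open>C\<close> and the ideal sheaf into its square, i.e. of the sheaf of derivations of the
  curve of multiplicity \<open>n - 1\<close> tensored with the ideal sheaf, under the usual identification.\<close>

definition ideal_derivations ::
  "('p, 's) cspace \<Rightarrow> ('p, 'r) cspace \<Rightarrow> ('p set \<Rightarrow> 'r \<Rightarrow> 's) \<Rightarrow> 'p set \<Rightarrow>
   ('p set \<Rightarrow> 'r \<Rightarrow> 'r) set" where
  "ideal_derivations C X \<pi> U = {D \<in> derivations X U. \<forall>V\<in>opens X. V \<subseteq> U \<longrightarrow>
     D V ` carrier (sec X V) \<subseteq> curve_ideal C X \<pi> V \<and>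
     D V ` curve_ideal C X \<pi> V \<subseteq> curve_ideal_square C X \<pi> V}"

text \<open>The exponential of a derivation, acting on sections. The sum runs over the \<open>k\<close> with nonzero
  term, which are finitely many for the derivations considered here.\<close>

definition exp_derivation ::
  "('p, 'r) cspace \<Rightarrow> ('p set \<Rightarrow> 'r \<Rightarrow> 'r) \<Rightarrow> 'p set \<Rightarrow> 'r \<Rightarrow> 'r" where
  "exp_derivation X D U s =
     (\<Oplus>\<^bsub>sec X U\<^esub>k\<in>{k. (D U ^^ k) s \<noteq> \<zero>\<^bsub>sec X U\<^esub>}.
        scal X U (1 / fact k) \<otimes>\<^bsub>sec X U\<^esub> (D U ^^ k) s)"

definition chi :: "('p, 'r) cspace \<Rightarrow> ('p set \<Rightarrow> 'r \<Rightarrow> 'r) \<Rightarrow> ('p, 'r, 'p, 'r) mor" where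
  "chi X D = (id, exp_derivation X D)"

end

theory Submission
  imports Defs "HOL-Computational_Algebra.Formal_Power_Series"
begin

text \<open>The derivation is the logarithm of the automorphism. Let \<open>N = \<phi> - 1\<close>, acting on the sections
  of the structure sheaf, and let \<open>I\<close> be the ideal sheaf of the reduced curve. As \<open>\<phi>\<close> induces the
  identity on \<open>C\<close> and on \<open>I/I\<^sup>2\<close>, the map \<open>N\<close> sends the structure sheaf to \<open>I\<close> and \<open>I\<close> to \<open>I\<^sup>2\<close>. From
  \<open>N (a b) = a N b + b N a + N a N b\<close> it follows that \<open>N\<close> sends \<open>I\<^sup>k\<close> to \<open>I\<^sup>k\<^sup>+\<^sup>1\<close>
  (\<open>T_ideal_power\<close>). In the charts \<open>I\<^sup>k\<close> consists of multiples of \<open>t\<^sup>k\<close>, so that \<open>I\<^sup>n = 0\<close>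
  (\<open>ideal_power_eq_zero\<close>) and \<open>N\<^sup>n = 0\<close>. Hence formal power series over \<open>\<complex>\<close> can be evaluated at \<open>N\<close>,
  compatibly with products and composition (\<open>ev_mult\<close>, \<open>ev_compose\<close>). Put \<open>D = ln (1 + N)\<close>; then
  \<open>exp D = 1 + N = \<phi>\<close> because the series \<open>exp X - 1\<close> and \<open>ln (1 + X)\<close> are inverse to each other
  under composition.

  The Leibniz rule for \<open>D\<close> comes from the multiplicativity of all the powers \<open>\<phi>\<^sup>m = exp (m D)\<close>
  (\<open>derivation_if_exp_mult\<close>). Both sides of \<open>\<phi>\<^sup>m (s t) = \<phi>\<^sup>m s \<phi>\<^sup>m t\<close> are polynomials in \<open>m\<close> with
  coefficients in the ring of sections; a polynomial that vanishes at all natural numbers has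
  vanishing coefficients (\<open>polynomial_zero\<close>), and the coefficients of \<open>m\<close> give
  \<open>D (s t) = s D t + t D s\<close>. Since \<open>D\<close> is a series in \<open>N\<close> without constant term, it commutes with
  restrictions and maps the structure sheaf to \<open>I\<close> and \<open>I\<close> to \<open>I\<^sup>2\<close>.

  Conversely, let \<open>E\<close> be a derivation as in the theorem with \<open>exp E = \<phi>\<close>. It raises the powers of
  \<open>I\<close> for the same reason as \<open>N\<close> and so is nilpotent; therefore
  \<open>E = ln (1 + (exp E - 1)) = ln (1 + N) = D\<close> (\<open>ln_exp\<close>).

  The logarithm is formed over each open set separately. The geometry enters only through the
  sheaf of ideals \<open>I\<close> and its nilpotency.\<close>

section \<open>Power series in a nilpotent operator\<close>

locale complex_algebra = cring R for R (structure) +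
  fixes \<sigma> :: "complex \<Rightarrow> 'a"
  assumes \<sigma>_hom: "\<sigma> \<in> ring_hom (ring_of_type_algebra :: complex ring) R"
begin

lemma \<sigma>_closed [simp]: "\<sigma> c \<in> carrier R"
  using ring_hom_closed[OF \<sigma>_hom, of c] by (simp add: ring_of_type_algebra_def)

lemma \<sigma>_add: "\<sigma> (c + d) = \<sigma> c \<oplus> \<sigma> d"
  using ring_hom_add[OF \<sigma>_hom, of c d] by (simp add: ring_of_type_algebra_def)

lemma \<sigma>_mult: "\<sigma> (c * d) = \<sigma> c \<otimes> \<sigma> d"
  using ring_hom_mult[OF \<sigma>_hom, of c d] by (simp add: ring_of_type_algebra_def)

lemma \<sigma>_one [simp]: "\<sigma> 1 = \<one>"
  using ring_hom_one[OF \<sigma>_hom] by (simp add: ring_of_type_algebra_def)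

lemma \<sigma>_zero [simp]: "\<sigma> 0 = \<zero>"
  using \<sigma>_add[of 0 0] by (metis \<sigma>_closed add.l_cancel_one' add.right_neutral)

lemma \<sigma>_assoc: "s \<in> carrier R \<Longrightarrow> \<sigma> c \<otimes> (\<sigma> d \<otimes> s) = \<sigma> (c * d) \<otimes> s"
  by (simp add: \<sigma>_mult m_assoc)

text \<open>The value of the power series \<open>f\<close> at the operator \<open>T\<close>, for operators with \<open>T\<^sup>n = 0\<close>. The cut at \<open>n\<close>
  gives one finite sum that serves all elements.\<close>

definition fps_op :: "nat \<Rightarrow> ('a \<Rightarrow> 'a) \<Rightarrow> complex fps \<Rightarrow> 'a \<Rightarrow> 'a" where
  "fps_op n T f s = (\<Oplus>k\<in>{..<n}. \<sigma> (fps_nth f k) \<otimes> (T ^^ k) s)"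

lemma power_closed:
  assumes "\<And>s. s \<in> carrier R \<Longrightarrow> T s \<in> carrier R" "s \<in> carrier R"
  shows "(T ^^ k) s \<in> carrier R"
  using assms by (induction k) auto

text \<open>Sections of the sheaf of derivations are extensional, whereas other operators are controlled only
  on the carrier; this and the next lemma make evaluation insensitive to the difference.\<close>

lemma power_cong:
  assumes "\<And>s. s \<in> carrier R \<Longrightarrow> T s \<in> carrier R" "\<And>s. s \<in> carrier R \<Longrightarrow> T s = T' s" "s \<in> carrier R"
  shows "(T ^^ k) s = (T' ^^ k) s"
proof (induction k)
  case (Suc k)
  have "T ((T ^^ k) s) = T' ((T ^^ k) s)"
    by (rule assms(2), rule power_closed) (use assms in auto)
  with Suc show ?case by simp
qed auto

lemma fps_op_cong:
  assumes "\<And>s. s \<in> carrier R \<Longrightarrow> T s \<in> carrier R" "\<And>s. s \<in> carrier R \<Longrightarrow> T s = T' s" "s \<in> carrier R"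
  shows "fps_op n T f s = fps_op n T' f s"
  unfolding fps_op_def
  by (rule finsum_cong') (use power_cong[OF assms] power_closed[OF assms(1,3)] in auto)

end

locale nilpotent_op = complex_algebra +
  fixes T :: "'a \<Rightarrow> 'a" and n :: nat
  assumes T_closed [simp]: "s \<in> carrier R \<Longrightarrow> T s \<in> carrier R"
    and T_add: "s \<in> carrier R \<Longrightarrow> t \<in> carrier R \<Longrightarrow> T (s \<oplus> t) = T s \<oplus> T t"
    and T_scale: "s \<in> carrier R \<Longrightarrow> T (\<sigma> c \<otimes> s) = \<sigma> c \<otimes> T s"
    and T_nilpotent: "s \<in> carrier R \<Longrightarrow> (T ^^ n) s = \<zero>"
begin

abbreviation ev :: "complex fps \<Rightarrow> 'a \<Rightarrow> 'a" where "ev \<equiv> fps_op n T"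

lemma T_power_closed [simp]: "s \<in> carrier R \<Longrightarrow> (T ^^ k) s \<in> carrier R"
  by (rule power_closed) auto

lemma T_zero [simp]: "T \<zero> = \<zero>"
  using T_scale[of \<zero> 0] by simp

lemma T_power_add:
  "s \<in> carrier R \<Longrightarrow> t \<in> carrier R \<Longrightarrow> (T ^^ k) (s \<oplus> t) = (T ^^ k) s \<oplus> (T ^^ k) t"
  by (induction k) (auto simp: T_add)

lemma T_power_scale: "s \<in> carrier R \<Longrightarrow> (T ^^ k) (\<sigma> c \<otimes> s) = \<sigma> c \<otimes> (T ^^ k) s"
  by (induction k) (auto simp: T_scale)

lemma T_power_vanish: "n \<le> k \<Longrightarrow> s \<in> carrier R \<Longrightarrow> (T ^^ k) s = \<zero>"
proof (induction k rule: dec_induct)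
  case base
  then show ?case by (rule T_nilpotent)
qed auto

lemma T_finsum:
  assumes "finite A" "g \<in> A \<rightarrow> carrier R"
  shows "T (\<Oplus>i\<in>A. g i) = (\<Oplus>i\<in>A. T (g i))"
  using assms
proof (induction A rule: finite_induct)
  case (insert a A)
  then have "(\<Oplus>i\<in>A. g i) \<in> carrier R" "(\<lambda>i. T (g i)) \<in> A \<rightarrow> carrier R"
    by (auto intro!: finsum_closed T_closed simp: Pi_iff)
  with insert show ?case
    by (simp add: T_add)
qed auto

lemma ev_closed [simp]: "s \<in> carrier R \<Longrightarrow> ev f s \<in> carrier R"
  unfolding fps_op_def by (rule finsum_closed) auto

lemma ev_add_arg:
  "s \<in> carrier R \<Longrightarrow> t \<in> carrier R \<Longrightarrow> ev f (s \<oplus> t) = ev f s \<oplus> ev f t"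
  unfolding fps_op_def
  by (subst finsum_addf[symmetric]) (auto intro!: finsum_cong' simp: T_power_add r_distr)

lemma ev_scale_arg:
  assumes "s \<in> carrier R" shows "ev f (\<sigma> c \<otimes> s) = \<sigma> c \<otimes> ev f s"
  unfolding fps_op_def using assms
  by (subst finsum_rdistr) (auto intro!: finsum_cong' simp: T_power_scale m_lcomm)

lemma ev_add: 
  "s \<in> carrier R \<Longrightarrow> ev (f + g) s = ev f s \<oplus> ev g s"
  unfolding fps_op_def
  by (subst finsum_addf[symmetric]) (auto intro!: finsum_cong' simp: \<sigma>_add l_distr)

lemma ev_const_mult:
  assumes "s \<in> carrier R" shows "ev (fps_const c * f) s = \<sigma> c \<otimes> ev f s"
  unfolding fps_op_def using assms
  by (subst finsum_rdistr) (auto intro!: finsum_cong' simp: \<sigma>_assoc)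

lemma ev_zero: "s \<in> carrier R \<Longrightarrow> ev 0 s = \<zero>"
  using ev_const_mult[of s 0 0] by simp

lemma ev_cong_nth:
  assumes "\<And>k. k < n \<Longrightarrow> fps_nth f k = fps_nth g k" "s \<in> carrier R"
  shows "ev f s = ev g s"
  unfolding fps_op_def using assms by (auto intro!: finsum_cong')

lemma ev_sum:
  assumes "finite A" "s \<in> carrier R"
  shows "ev (\<Sum>i\<in>A. h i) s = (\<Oplus>i\<in>A. ev (h i) s)"
  using assms by (induction A rule: finite_induct) (auto simp: ev_zero ev_add)

lemma ev_one:
  assumes "s \<in> carrier R"
  shows "ev 1 s = s"
proof (cases n)
  case 0
  with T_nilpotent[OF assms] show ?thesis by (simp add: fps_op_def)
next
  case (Suc m)
  have "ev 1 s = (\<Oplus>k\<in>{..<n}. if k = 0 then s else \<zero>)"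
    unfolding fps_op_def using assms by (auto intro!: finsum_cong')
  also have "\<dots> = s"
    using assms Suc finsum_singleton[of 0 "{..<n}" "\<lambda>_. s"] by (simp add: eq_commute[of 0])
  finally show ?thesis .
qed

text \<open>This is where nilpotency enters: multiplication by \<open>X\<close> shifts the coefficients, and the one that
  is shifted out of the cut belongs to \<open>T\<^sup>n = 0\<close>.\<close>

lemma ev_X_mult:
  assumes s: "s \<in> carrier R"
  shows "ev (fps_X * f) s = T (ev f s)"
proof (cases n)
  case 0
  then show ?thesis by (simp add: fps_op_def)
next
  case (Suc m)
  let ?a = "\<lambda>k. \<sigma> (fps_nth f k) \<otimes> (T ^^ Suc k) s"
  have a: "?a k \<in> carrier R" for k using T_power_closed[OF s, of "Suc k"] by simp
  have "T (ev f s) = (\<Oplus>k\<in>{..<n}. ?a k)"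
    unfolding fps_op_def using s by (subst T_finsum) (auto intro!: finsum_cong' simp: T_scale)
  also have "\<dots> = (\<Oplus>k\<in>{..m}. ?a k)"
    by (simp add: Suc lessThan_Suc_atMost del: funpow.simps)
  also have "\<dots> = (\<Oplus>k\<in>{..<m}. ?a k)"
  proof -
    have "{..m} = insert m {..<m}" by auto
    then show ?thesis
      using a T_power_vanish[of "Suc m" s] s Suc
      by (simp add: Pi_iff del: funpow.simps)
  qed
  also have "\<dots> = ev (fps_X * f) s"
  proof -
    have "{..<n} = insert 0 (Suc ` {..<m})"
      using Suc by (simp add: lessThan_Suc_eq_insert_0)
    moreover have "(\<Oplus>k\<in>Suc ` {..<m}. \<sigma> (fps_nth (fps_X * f) k) \<otimes> (T ^^ k) s) = (\<Oplus>k\<in>{..<m}. ?a k)"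
      using s by (subst finsum_reindex) (auto simp del: funpow.simps)
    ultimately show ?thesis
      unfolding fps_op_def using s a
      by (subst (asm) eq_commute) (simp add: Pi_iff del: funpow.simps)
  qed
  finally show ?thesis by simp
qed

lemma ev_X_power_mult:
  assumes s: "s \<in> carrier R"
  shows "ev (fps_X ^ k * f) s = (T ^^ k) (ev f s)"
  using s by (induction k) (auto simp: mult.assoc ev_X_mult)

text \<open>By linearity the first factor may be taken to be a power of \<open>X\<close>, once its coefficients beyond the
  cut are dropped; no double sum has to be rearranged.\<close>

lemma ev_mult:
  assumes s: "s \<in> carrier R"
  shows "ev (f * g) s = ev f (ev g s)"
proof -
  let ?f = "\<Sum>i<n. fps_const (fps_nth f i) * fps_X ^ i"
  have f: "fps_nth f k = fps_nth ?f k" if "k < n" for k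
    using that by (simp add: fps_sum_nth fps_X_power_nth mult_delta_right)
  have "ev (f * g) s = ev (?f * g) s"
    using s f by (intro ev_cong_nth) (auto simp: fps_mult_nth intro!: sum.cong)
  also have "\<dots> = ev (\<Sum>i<n. fps_const (fps_nth f i) * (fps_X ^ i * g)) s"
    by (simp add: sum_distrib_right mult.assoc)
  also have "\<dots> = (\<Oplus>i\<in>{..<n}. \<sigma> (fps_nth f i) \<otimes> (T ^^ i) (ev g s))"
    using s by (simp add: ev_sum ev_const_mult ev_X_power_mult)
  finally show ?thesis by (simp add: fps_op_def)
qed

lemma ev_power:
  assumes s: "s \<in> carrier R"
  shows "(ev f ^^ k) s = ev (f ^ k) s"
  using s by (induction k) (auto simp: ev_one ev_mult)

text \<open>As \<open>g\<close> has no constant term, \<open>g\<^sup>i\<close> starts in degree \<open>i\<close> or later, so below degree \<open>n\<close> the composite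
  is the sum of the \<open>f\<^sub>i g\<^sup>i\<close> with \<open>i < n\<close>.\<close>

lemma ev_compose:
  assumes s: "s \<in> carrier R" and g: "fps_nth g 0 = 0"
  shows "fps_op n (ev g) f s = ev (f oo g) s"
proof -
  have "fps_op n (ev g) f s = (\<Oplus>i\<in>{..<n}. ev (fps_const (fps_nth f i) * g ^ i) s)"
    unfolding fps_op_def[of n "ev g"] using s by (simp add: ev_power ev_const_mult)
  also have "\<dots> = ev (\<Sum>i<n. fps_const (fps_nth f i) * g ^ i) s"
    using s by (simp add: ev_sum)
  also have "\<dots> = ev (f oo g) s"
  proof (rule ev_cong_nth)
    fix k assume "k < n"
    then have "(\<Sum>i<n. fps_nth f i * fps_nth (g ^ i) k) = (\<Sum>i=0..k. fps_nth f i * fps_nth (g ^ i) k)"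
      by (intro sum.mono_neutral_right) (auto simp: startsby_zero_power_prefix[OF g])
    then show "fps_nth (\<Sum>i<n. fps_const (fps_nth f i) * g ^ i) k = fps_nth (f oo g) k"
      by (simp add: fps_sum_nth fps_compose_nth)
  qed (rule s)
  finally show ?thesis .
qed

lemma ev_X: "s \<in> carrier R \<Longrightarrow> ev fps_X s = T s"
  using ev_X_mult[of s 1] by (simp add: ev_one)

lemma nilpotent_op_ev:
  assumes "fps_nth g 0 = 0"
  shows "nilpotent_op R \<sigma> (ev g) n"
proof unfold_locales
  fix s assume s: "s \<in> carrier R"
  have "ev (g ^ n) s = ev 0 s"
    using s by (intro ev_cong_nth) (auto simp: startsby_zero_power_prefix[OF assms])
  then show "(ev g ^^ n) s = \<zero>"
    using s by (simp add: ev_power ev_zero)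
qed (auto simp: ev_add_arg ev_scale_arg)

end

text \<open>The series \<open>fps_ln 1\<close> is that of \<open>ln (1 + X)\<close>.\<close>

lemma fps_ln_exp: "fps_ln 1 oo (fps_exp 1 - 1) = (fps_X :: complex fps)"
  by (simp add: fps_ln_fps_exp_inv fps_inv)

lemma fps_exp_ln: "fps_exp 1 oo fps_ln 1 = (1 + fps_X :: complex fps)"
proof -
  have "(fps_exp 1 - 1) oo fps_ln 1 = (fps_X :: complex fps)"
    by (simp add: fps_ln_fps_exp_inv fps_inv_right)
  then show ?thesis
    by (simp add: fps_compose_sub_distrib algebra_simps)
qed

section \<open>The logarithm of a unipotent automorphism\<close>

context complex_algebra begin

lemma \<sigma>_cancel:
  assumes "\<sigma> c \<otimes> s = \<zero>" "c \<noteq> 0" "s \<in> carrier R"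
  shows "s = \<zero>"
proof -
  have "s = \<sigma> (inverse c) \<otimes> (\<sigma> c \<otimes> s)"
    using assms(2,3) by (simp add: \<sigma>_assoc)
  then show ?thesis using assms(1) by simp
qed

text \<open>Induction on the degree bound: if the degree of \<open>P\<close> is at most \<open>d\<close>, then \<open>P (2m) - 2\<^sup>d P m\<close> has
  degree less than \<open>d\<close>, and its coefficients are those of \<open>P\<close> multiplied by the nonzero numbers
  \<open>2\<^sup>k - 2\<^sup>d\<close>. The value at \<open>1\<close> then takes care of the leading coefficient.\<close>

lemma polynomial_zero:
  assumes "\<And>k. e k \<in> carrier R"
    and "\<And>m::nat. (\<Oplus>k\<in>{..K}. \<sigma> (of_nat m ^ k) \<otimes> e k) = \<zero>"
    and "k \<le> K"
  shows "e k = \<zero>"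
  using assms
proof (induction K arbitrary: e k)
  case 0
  then show ?case using "0.prems"(2)[of 0] by simp
next
  case (Suc K)
  let ?P = "\<lambda>e K (m::nat). \<Oplus>k\<in>{..K}. \<sigma> (of_nat m ^ k) \<otimes> e k"
  let ?d = "\<lambda>k. (2::complex) ^ k - 2 ^ Suc K"
  note e = Suc.prems(1) and P = Suc.prems(2)
  have van: "\<sigma> (?d k) \<otimes> e k = \<zero>" if "k \<le> K" for k
  proof (rule Suc.IH[OF _ _ that])
    fix m :: nat
    have "\<zero> = ?P e (Suc K) (2 * m) \<oplus> \<sigma> (- (2 ^ Suc K)) \<otimes> ?P e (Suc K) m"
      unfolding P by simp
    also have "\<dots> = (\<Oplus>k\<in>{..Suc K}. \<sigma> (of_nat (2 * m) ^ k) \<otimes> e k \<oplus> \<sigma> (- (2 ^ Suc K)) \<otimes> (\<sigma> (of_nat m ^ k) \<otimes> e k))"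
      using e by (subst finsum_rdistr, simp, simp, simp) (subst finsum_addf, auto)
    also have "\<dots> = ?P (\<lambda>k. \<sigma> (?d k) \<otimes> e k) (Suc K) m"
      using e
      by (intro finsum_cong')
        (auto simp: \<sigma>_assoc l_distr[symmetric] \<sigma>_add[symmetric] power_mult_distrib algebra_simps)
    also have "\<dots> = ?P (\<lambda>k. \<sigma> (?d k) \<otimes> e k) K m"
      using e by (simp add: atMost_Suc Pi_iff)
    finally show "?P (\<lambda>k. \<sigma> (?d k) \<otimes> e k) K m = \<zero>" by simp
  qed (use e in auto)
  have low: "e k = \<zero>" if "k \<le> K" for k
  proof (rule \<sigma>_cancel[OF van[OF that] _ e])
    have "(2::nat) ^ k < 2 ^ Suc K"
      using that by (intro power_strict_increasing) auto
    then have "of_nat (2 ^ k) \<noteq> (of_nat (2 ^ Suc K) :: complex)"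
      unfolding of_nat_eq_iff by simp
    then show "?d k \<noteq> 0" by simp
  qed
  have "e (Suc K) = ?P e (Suc K) 1"
    using e low add.finprod_one_eqI[of "{..K}" e] by (simp add: atMost_Suc Pi_iff)
  also have "\<dots> = \<zero>" by (rule P)
  finally show ?case
    using low Suc.prems(3) by (cases "k = Suc K") auto
qed

lemma polynomial_eq:
  assumes e: "\<And>k. e k \<in> carrier R" and f: "\<And>k. f k \<in> carrier R"
    and eq: "\<And>m::nat. (\<Oplus>k\<in>{..K}. \<sigma> (of_nat m ^ k) \<otimes> e k) = (\<Oplus>k\<in>{..K}. \<sigma> (of_nat m ^ k) \<otimes> f k)"
    and k: "k \<le> K"
  shows "e k = f k"
proof -
  let ?g = "\<lambda>k. e k \<oplus> \<sigma> (- 1) \<otimes> f k"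
  have m1: "s \<oplus> \<sigma> (- 1) \<otimes> s = \<zero>" if "s \<in> carrier R" for s
  proof -
    have "s \<oplus> \<sigma> (- 1) \<otimes> s = \<sigma> (1 + - 1) \<otimes> s"
      using that unfolding \<sigma>_add by (simp add: l_distr)
    with that show ?thesis by simp
  qed
  have "?g k = \<zero>"
  proof (rule polynomial_zero[OF _ _ k])
    fix m :: nat
    have "(\<Oplus>k\<in>{..K}. \<sigma> (of_nat m ^ k) \<otimes> ?g k)
        = (\<Oplus>k\<in>{..K}. \<sigma> (of_nat m ^ k) \<otimes> e k \<oplus> \<sigma> (- 1) \<otimes> (\<sigma> (of_nat m ^ k) \<otimes> f k))"
      using e f by (intro finsum_cong') (auto simp: r_distr m_lcomm)
    also have "\<dots> = (\<Oplus>k\<in>{..K}. \<sigma> (of_nat m ^ k) \<otimes> e k) \<oplus> \<sigma> (- 1) \<otimes> (\<Oplus>k\<in>{..K}. \<sigma> (of_nat m ^ k) \<otimes> f k)"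
      using e f by (subst finsum_rdistr, simp, simp, simp) (subst finsum_addf, auto)
    also have "\<dots> = \<zero>"
      unfolding eq using f by (intro m1 finsum_closed) auto
    finally show "(\<Oplus>k\<in>{..K}. \<sigma> (of_nat m ^ k) \<otimes> ?g k) = \<zero>" .
  qed (use e f in auto)
  moreover have "e k = ?g k \<oplus> f k"
    using e[of k] f[of k] m1[of "f k"] by (simp add: a_assoc a_comm[of "\<sigma> (- 1) \<otimes> f k"])
  ultimately show ?thesis using f by simp
qed

end

context nilpotent_op begin

text \<open>The \<open>m\<close>-th power of the exponential of \<open>T\<close> is the polynomial \<open>\<Sum>k. m\<^sup>k T\<^sup>k / k!\<close> in \<open>m\<close>, and it is
  multiplicative for each \<open>m\<close>. The Leibniz rule is the comparison of the coefficients of \<open>m\<close>.\<close>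

lemma derivation_if_exp_mult:
  assumes mult: "\<And>s t. s \<in> carrier R \<Longrightarrow> t \<in> carrier R \<Longrightarrow>
      ev (fps_exp 1) (s \<otimes> t) = ev (fps_exp 1) s \<otimes> ev (fps_exp 1) t"
    and s: "s \<in> carrier R" and t: "t \<in> carrier R"
  shows "T (s \<otimes> t) = s \<otimes> T t \<oplus> t \<otimes> T s"
proof -
  define e where "e r k = \<sigma> (1 / fact k) \<otimes> (T ^^ k) r" for r k
  have e: "e r k \<in> carrier R" if "r \<in> carrier R" for r k
    using that by (simp add: e_def)
  have e0: "e r k = \<zero>" if "r \<in> carrier R" "n < k" for r k
    using that by (simp add: e_def T_power_vanish)
  \<comment> \<open>For \<open>n = 0\<close> the bound \<open>n + n\<close> would not reach the coefficient of \<open>m\<close>.\<close>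
  let ?K = "n + n + 1"
  have exp: "ev (fps_exp (of_nat m)) r = (\<Oplus>k\<in>{..N}. \<sigma> (of_nat m ^ k) \<otimes> e r k)"
    if r: "r \<in> carrier R" and N: "n \<le> N" for m N r
    unfolding fps_op_def using r N
    by (intro add.finprod_mono_neutral_cong) (auto simp: e_def \<sigma>_assoc T_power_vanish)
  have pow: "(ev (fps_exp 1) ^^ m) r = ev (fps_exp (of_nat m)) r" if "r \<in> carrier R" for m r
    using that by (simp add: ev_power fps_exp_power_mult)
  have mult_m: "(ev (fps_exp 1) ^^ m) (s \<otimes> t) = (ev (fps_exp 1) ^^ m) s \<otimes> (ev (fps_exp 1) ^^ m) t" for m
    using s t by (induction m) (auto simp: mult power_closed)
  let ?c = "\<lambda>k. \<Oplus>i\<in>{..k}. e s i \<otimes> e t (k - i)"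
  have "e (s \<otimes> t) 1 = ?c 1"
  proof (rule polynomial_eq[where K = ?K])
    fix m :: nat
    let ?a = "\<lambda>r k. \<sigma> (of_nat m ^ k) \<otimes> e r k"
    have "(\<Oplus>k\<in>{..?K}. \<sigma> (of_nat m ^ k) \<otimes> e (s \<otimes> t) k) = (\<Oplus>k\<in>{..n}. ?a s k) \<otimes> (\<Oplus>k\<in>{..n+1}. ?a t k)"
      using s t exp[of "s \<otimes> t" ?K m] exp[of s n m] exp[of t "n+1" m] mult_m[of m] by (simp add: pow)
    also have "\<dots> = (\<Oplus>k\<in>{..n + (n+1)}. \<Oplus>i\<in>{..k}. ?a s i \<otimes> ?a t (k - i))"
      using s t by (subst cauchy_product) (auto simp: e e0)
    also have "\<dots> = (\<Oplus>k\<in>{..?K}. \<sigma> (of_nat m ^ k) \<otimes> ?c k)"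
    proof (intro finsum_cong')
      fix k
      have "?a s i \<otimes> ?a t (k - i) = \<sigma> (of_nat m ^ k) \<otimes> (e s i \<otimes> e t (k - i))" if "i \<le> k" for i
      proof -
        have "?a s i \<otimes> ?a t (k - i) = \<sigma> (of_nat m ^ i * of_nat m ^ (k - i)) \<otimes> (e s i \<otimes> e t (k - i))"
          using e[OF s] e[OF t] by (simp add: \<sigma>_mult m_ac)
        with that show ?thesis by (simp flip: power_add)
      qed
      then show "(\<Oplus>i\<in>{..k}. ?a s i \<otimes> ?a t (k - i)) = \<sigma> (of_nat m ^ k) \<otimes> ?c k"
        using e[OF s] e[OF t] by (subst finsum_rdistr) (auto intro!: finsum_cong')
    qed (use e[OF s] e[OF t] in auto)
    finally show "(\<Oplus>k\<in>{..?K}. \<sigma> (of_nat m ^ k) \<otimes> e (s \<otimes> t) k) = (\<Oplus>k\<in>{..?K}. \<sigma> (of_nat m ^ k) \<otimes> ?c k)" .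
  qed (use s t e in auto)
  moreover have "{..Suc 0} = {0, Suc 0}" by auto
  ultimately show ?thesis
    using s t by (simp add: e_def m_comm a_comm)
qed

lemma exp_ln:
  "s \<in> carrier R \<Longrightarrow> fps_op n (ev (fps_ln 1)) (fps_exp 1) s = s \<oplus> T s"
  by (simp add: ev_compose fps_exp_ln ev_add ev_one ev_X)

text \<open>Since \<open>exp T = 1 + N\<close> by hypothesis, the nilpotent operator \<open>T\<close> can be recovered from its
  exponential; this is the source of uniqueness.\<close>

lemma ln_exp:
  assumes exp: "\<And>s. s \<in> carrier R \<Longrightarrow> ev (fps_exp 1) s = s \<oplus> N s"
    and N: "\<And>s. s \<in> carrier R \<Longrightarrow> N s \<in> carrier R"
    and s: "s \<in> carrier R"
  shows "fps_op n N (fps_ln 1) s = T s"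
proof -
  have "N r = ev (fps_exp 1 - 1) r" if r: "r \<in> carrier R" for r
  proof -
    have "r \<oplus> N r = ev (1 + (fps_exp 1 - 1)) r"
      using exp[OF r] by simp
    also have "\<dots> = r \<oplus> ev (fps_exp 1 - 1) r"
      unfolding ev_add[OF r] ev_one[OF r] ..
    finally show ?thesis
      using r N[OF r] by simp
  qed
  then have "fps_op n N (fps_ln 1) s = fps_op n (ev (fps_exp 1 - 1)) (fps_ln 1) s"
    using N s by (intro fps_op_cong) auto
  also have "\<dots> = T s"
    using s by (simp add: ev_compose fps_ln_exp ev_X)
  finally show ?thesis .
qed

text \<open>The hypothesis says that \<open>1 + T\<close> is multiplicative, and \<open>1 + T\<close> is the exponential of the logarithm.\<close>

lemma ln_derivation:
  assumes mult: "\<And>s t. s \<in> carrier R \<Longrightarrow> t \<in> carrier R \<Longrightarrow>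
      s \<otimes> t \<oplus> T (s \<otimes> t) = (s \<oplus> T s) \<otimes> (t \<oplus> T t)"
    and s: "s \<in> carrier R" and t: "t \<in> carrier R"
  shows "ev (fps_ln 1) (s \<otimes> t) = s \<otimes> ev (fps_ln 1) t \<oplus> t \<otimes> ev (fps_ln 1) s"
proof -
  interpret D: nilpotent_op R \<sigma> "ev (fps_ln 1)" n
    by (rule nilpotent_op_ev) simp
  show ?thesis
    using s t mult by (intro D.derivation_if_exp_mult) (auto simp: exp_ln)
qed

text \<open>The left side has the form in which the exponential of a derivation is defined: a sum over
  the nonvanishing terms.\<close>

lemma finsum_support_exp:
  assumes s: "s \<in> carrier R"
  shows "(\<Oplus>k\<in>{k. (T ^^ k) s \<noteq> \<zero>}. \<sigma> (1 / fact k) \<otimes> (T ^^ k) s) = ev (fps_exp 1) s"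
  unfolding fps_op_def
proof (rule add.finprod_mono_neutral_cong_left)
  show "{k. (T ^^ k) s \<noteq> \<zero>} \<subseteq> {..<n}"
    using T_power_vanish[OF _ s] by (force simp: not_le[symmetric])
qed (use s in auto)

text \<open>Intended for the logarithm, which has no constant term, so that \<open>s\<close> itself need not lie in the
  ideal.\<close>

lemma ev_mem_ideal:
  assumes "ideal I R" "s \<in> carrier R" "\<And>k. fps_nth f k \<noteq> 0 \<Longrightarrow> (T ^^ k) s \<in> I"
  shows "ev f s \<in> I"
proof -
  interpret I: ideal I R by fact
  have mem: "\<sigma> (fps_nth f k) \<otimes> (T ^^ k) s \<in> I" for k
    using assms(2) assms(3)[of k] by (cases "fps_nth f k = 0") (auto intro: I.I_l_closed)
  have "(\<Oplus>k\<in>A. \<sigma> (fps_nth f k) \<otimes> (T ^^ k) s) \<in> I" if "finite A" for A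
    using that
  proof (induction A rule: finite_induct)
    case (insert a A)
    then show ?case using mem assms(2) by simp
  qed simp
  then show ?thesis by (simp add: fps_op_def)
qed

lemma ev_hom:
  assumes S: "complex_algebra S \<tau>" and h: "h \<in> ring_hom R S" "\<And>c. h (\<sigma> c) = \<tau> c"
    and T': "\<And>s. s \<in> carrier R \<Longrightarrow> T' (h s) = h (T s)"
    and s: "s \<in> carrier R"
  shows "h (ev f s) = complex_algebra.fps_op S \<tau> n T' f (h s)"
proof -
  interpret S: complex_algebra S \<tau> by fact
  interpret h: ring_hom_cring R S h
    by unfold_locales (rule h)
  have pow: "h ((T ^^ k) s) = (T' ^^ k) (h s)" for k
    using s by (induction k) (auto simp: T'[symmetric])
  then show ?thesis
    unfolding fps_op_def S.fps_op_def using s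
    by (subst h.hom_finsum) (auto intro!: S.finsum_cong' simp: h pow[symmetric])
qed

end

section \<open>Ideal sheaves and their powers\<close>

lemma (in cring) ideal_if_closed:
  assumes "I \<subseteq> carrier R" "\<zero> \<in> I" "\<And>a b. a \<in> I \<Longrightarrow> b \<in> I \<Longrightarrow> a \<oplus> b \<in> I"
    and l: "\<And>a b. a \<in> carrier R \<Longrightarrow> b \<in> I \<Longrightarrow> a \<otimes> b \<in> I"
  shows "ideal I R"
proof (rule idealI)
  show "subgroup I (add_monoid R)"
  proof (rule add.subgroupI)
    show "\<ominus> a \<in> I" if "a \<in> I" for a
      using l[of "\<ominus> \<one>" a] assms(1) that by (auto simp: l_minus)
  qed (use assms in auto)
  fix a x assume "a \<in> I" "x \<in> carrier R"
  then show "x \<otimes> a \<in> I" "a \<otimes> x \<in> I"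
    using l[of x a] assms(1) by (auto simp: m_comm[of a x])
qed (rule ring_axioms)

text \<open>Products of ideals over each open set give only a presheaf of ideals; the product of ideal sheaves
  is recovered from it by passing to the sections that belong to it locally.\<close>

definition ideal_presheaf :: "('p, 'r) cspace \<Rightarrow> ('p set \<Rightarrow> 'r set) \<Rightarrow> bool" where
  "ideal_presheaf X J \<longleftrightarrow> (\<forall>U\<in>opens X. ideal (J U) (sec X U)) \<and>
     (\<forall>U\<in>opens X. \<forall>V\<in>opens X. V \<subseteq> U \<longrightarrow> res X U V ` J U \<subseteq> J V)"

definition locally_in :: "('p, 'r) cspace \<Rightarrow> ('p set \<Rightarrow> 'r set) \<Rightarrow> 'p set \<Rightarrow> 'r set" where
  "locally_in X J U = {s \<in> carrier (sec X U).
     \<forall>x\<in>U. \<exists>W\<in>opens X. x \<in> W \<and> W \<subseteq> U \<and> res X U W s \<in> J W}"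

definition ideal_sheaf :: "('p, 'r) cspace \<Rightarrow> ('p set \<Rightarrow> 'r set) \<Rightarrow> bool" where
  "ideal_sheaf X J \<longleftrightarrow> ideal_presheaf X J \<and> (\<forall>U\<in>opens X. locally_in X J U \<subseteq> J U)"

lemma ideal_sheaf_prod_eq:
  "ideal_sheaf_prod X I J = locally_in X (\<lambda>W. ideal_prod (sec X W) (I W) (J W))"
  by (simp add: fun_eq_iff ideal_sheaf_prod_def locally_in_def)

text \<open>The index is shifted: \<open>ideal_power X I k\<close> is the power of exponent \<open>k + 1\<close>. In this way the
  recursion starts with \<open>I\<close> itself, and the index \<open>1\<close> is literally the square.\<close>

primrec ideal_power :: "('p, 'r) cspace \<Rightarrow> ('p set \<Rightarrow> 'r set) \<Rightarrow> nat \<Rightarrow> 'p set \<Rightarrow> 'r set" where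
  "ideal_power X I 0 = I"
| "ideal_power X I (Suc k) = ideal_sheaf_prod X I (ideal_power X I k)"

locale ringed_cspace =
  fixes X :: "('p, 'r) cspace"
  assumes ringed: "ringed_space X"
begin

lemma complex_algebra_sec: "U \<in> opens X \<Longrightarrow> complex_algebra (sec X U) (scal X U)"
  using ringed
  by (simp add: ringed_space_def presheaf_def complex_algebra_def complex_algebra_axioms_def)

lemma cring_sec: "U \<in> opens X \<Longrightarrow> cring (sec X U)"
  using complex_algebra_sec by (simp add: complex_algebra_def)

lemma res_ring_hom:
  "U \<in> opens X \<Longrightarrow> V \<in> opens X \<Longrightarrow> V \<subseteq> U \<Longrightarrow> ring_hom_cring (sec X U) (sec X V) (res X U V)"
  using ringed cring_sec
  by (simp add: ringed_space_def presheaf_def ring_hom_cring_def ring_hom_cring_axioms_def)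

lemma res_scal:
  "U \<in> opens X \<Longrightarrow> V \<in> opens X \<Longrightarrow> V \<subseteq> U \<Longrightarrow> res X U V (scal X U c) = scal X V c"
  using ringed by (simp add: ringed_space_def presheaf_def)

lemma res_id: "U \<in> opens X \<Longrightarrow> s \<in> carrier (sec X U) \<Longrightarrow> res X U U s = s"
  using ringed by (simp add: ringed_space_def presheaf_def)

lemma res_res:
  "U \<in> opens X \<Longrightarrow> V \<in> opens X \<Longrightarrow> W \<in> opens X \<Longrightarrow> W \<subseteq> V \<Longrightarrow> V \<subseteq> U \<Longrightarrow>
     s \<in> carrier (sec X U) \<Longrightarrow> res X V W (res X U V s) = res X U W s"
  using ringed by (simp add: ringed_space_def presheaf_def)

lemma res_closed:
  "U \<in> opens X \<Longrightarrow> V \<in> opens X \<Longrightarrow> V \<subseteq> U \<Longrightarrow> s \<in> carrier (sec X U) \<Longrightarrow> res X U V s \<in> carrier (sec X V)"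
  by (rule ring_hom_closed[OF ring_hom_cring.homh[OF res_ring_hom]])

lemma eq_if_locally_eq:
  assumes U: "U \<in> opens X" and s: "s \<in> carrier (sec X U)" and t: "t \<in> carrier (sec X U)"
    and loc: "\<And>x. x \<in> U \<Longrightarrow> \<exists>W\<in>opens X. x \<in> W \<and> W \<subseteq> U \<and> res X U W s = res X U W t"
  shows "s = t"
proof -
  let ?\<U> = "{W \<in> opens X. W \<subseteq> U \<and> res X U W s = res X U W t}"
  have Un: "\<Union>?\<U> = U" using loc by blast
  have sep: "\<forall>\<U>\<subseteq>opens X. \<forall>s\<in>carrier (sec X (\<Union>\<U>)). \<forall>t\<in>carrier (sec X (\<Union>\<U>)).
      (\<forall>V\<in>\<U>. res X (\<Union>\<U>) V s = res X (\<Union>\<U>) V t) \<longrightarrow> s = t"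
    using ringed unfolding ringed_space_def by (elim conjE)
  show ?thesis
    by (rule sep[rule_format, of ?\<U>], unfold Un) (use s t in blast)+
qed

lemma ideal_sheaf_locally_in:
  assumes "ideal_presheaf X J"
  shows "ideal_sheaf X (locally_in X J)"
proof -
  have idl: "ideal (J U) (sec X U)" if "U \<in> opens X" for U
    using assms that by (simp add: ideal_presheaf_def)
  have resJ: "res X U V s \<in> J V" if "U \<in> opens X" "V \<in> opens X" "V \<subseteq> U" "s \<in> J U" for U V s
    using assms that unfolding ideal_presheaf_def by blast
  have "ideal (locally_in X J U) (sec X U)" if U: "U \<in> opens X" for U
  proof -
    interpret cring "sec X U" by (rule cring_sec[OF U])
    show ?thesis
    proof (rule ideal_if_closed)
      show "\<zero>\<^bsub>sec X U\<^esub> \<in> locally_in X J U"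
        unfolding locally_in_def
      proof (intro CollectI conjI ballI)
        fix x assume "x \<in> U"
        interpret J: ideal "J U" "sec X U" by (rule idl[OF U])
        show "\<exists>W\<in>opens X. x \<in> W \<and> W \<subseteq> U \<and> res X U W \<zero>\<^bsub>sec X U\<^esub> \<in> J W"
          using U \<open>x \<in> U\<close> by (intro bexI[of _ U]) (auto simp: res_id)
      qed simp
    next
      fix a b assume a: "a \<in> locally_in X J U" and b: "b \<in> locally_in X J U"
      show "a \<oplus>\<^bsub>sec X U\<^esub> b \<in> locally_in X J U"
        unfolding locally_in_def
      proof (intro CollectI conjI ballI)
        fix x assume "x \<in> U"
        with a obtain V where V: "V \<in> opens X" "x \<in> V" "V \<subseteq> U" "res X U V a \<in> J V"
          unfolding locally_in_def by blast
        from b \<open>x \<in> U\<close> obtain W where W: "W \<in> opens X" "x \<in> W" "W \<subseteq> U" "res X U W b \<in> J W"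
          unfolding locally_in_def by blast
        let ?Y = "V \<inter> W"
        have Y: "?Y \<in> opens X" using V W by auto
        interpret r: ring_hom_cring "sec X U" "sec X ?Y" "res X U ?Y"
          by (rule res_ring_hom) (use U Y V in auto)
        interpret J: ideal "J ?Y" "sec X ?Y" by (rule idl[OF Y])
        have "res X U ?Y a \<in> J ?Y"
          using resJ[OF V(1) Y _ V(4)] res_res[OF U V(1) Y _ V(3)] a by (simp add: locally_in_def)
        moreover have "res X U ?Y b \<in> J ?Y"
          using resJ[OF W(1) Y _ W(4)] res_res[OF U W(1) Y _ W(3)] b by (simp add: locally_in_def)
        ultimately have "res X U ?Y (a \<oplus>\<^bsub>sec X U\<^esub> b) \<in> J ?Y"
          using a b by (simp add: locally_in_def)
        then show "\<exists>W\<in>opens X. x \<in> W \<and> W \<subseteq> U \<and> res X U W (a \<oplus>\<^bsub>sec X U\<^esub> b) \<in> J W"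
          using V W Y by (intro bexI[of _ ?Y]) auto
      qed (use a b in \<open>simp add: locally_in_def\<close>)
    next
      fix a b assume a: "a \<in> carrier (sec X U)" and b: "b \<in> locally_in X J U"
      show "a \<otimes>\<^bsub>sec X U\<^esub> b \<in> locally_in X J U"
        unfolding locally_in_def
      proof (intro CollectI conjI ballI)
        fix x assume "x \<in> U"
        with b obtain W where W: "W \<in> opens X" "x \<in> W" "W \<subseteq> U" "res X U W b \<in> J W"
          unfolding locally_in_def by blast
        interpret r: ring_hom_cring "sec X U" "sec X W" "res X U W"
          by (rule res_ring_hom[OF U W(1,3)])
        interpret J: ideal "J W" "sec X W" by (rule idl[OF W(1)])
        have "res X U W (a \<otimes>\<^bsub>sec X U\<^esub> b) \<in> J W"
          using a b W(4) by (simp add: locally_in_def J.I_l_closed)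
        with W show "\<exists>W\<in>opens X. x \<in> W \<and> W \<subseteq> U \<and> res X U W (a \<otimes>\<^bsub>sec X U\<^esub> b) \<in> J W"
          by blast
      qed (use a b in \<open>simp add: locally_in_def\<close>)
    qed (auto simp: locally_in_def)
  qed
  moreover have "res X U V s \<in> locally_in X J V"
    if U: "U \<in> opens X" and V: "V \<in> opens X" "V \<subseteq> U" and s: "s \<in> locally_in X J U" for U V s
    unfolding locally_in_def
  proof (intro CollectI conjI ballI)
    fix x assume x: "x \<in> V"
    with s V obtain W where W: "W \<in> opens X" "x \<in> W" "W \<subseteq> U" "res X U W s \<in> J W"
      unfolding locally_in_def by blast
    have Y: "V \<inter> W \<in> opens X" using V W by auto
    have sU: "s \<in> carrier (sec X U)" using s by (simp add: locally_in_def)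
    have "res X V (V \<inter> W) (res X U V s) \<in> J (V \<inter> W)"
      using resJ[OF W(1) Y _ W(4)] res_res[OF U W(1) Y _ W(3) sU] res_res[OF U V(1) Y _ V(2) sU]
      by simp
    then show "\<exists>W\<in>opens X. x \<in> W \<and> W \<subseteq> V \<and> res X V W (res X U V s) \<in> J W"
      using x W Y by (intro bexI[of _ "V \<inter> W"]) auto
  qed (use U V s in \<open>auto simp: locally_in_def intro: res_closed\<close>)
  moreover have "s \<in> locally_in X J U"
    if U: "U \<in> opens X" and s: "s \<in> locally_in X (locally_in X J) U" for U s
    unfolding locally_in_def
  proof (intro CollectI conjI ballI)
    show sU: "s \<in> carrier (sec X U)" using s by (simp add: locally_in_def)
    fix x assume x: "x \<in> U"
    with s obtain V where V: "V \<in> opens X" "x \<in> V" "V \<subseteq> U" "res X U V s \<in> locally_in X J V"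
      unfolding locally_in_def[of X "locally_in X J"] by blast
    then obtain W where W: "W \<in> opens X" "x \<in> W" "W \<subseteq> V" "res X V W (res X U V s) \<in> J W"
      unfolding locally_in_def by blast
    then show "\<exists>W\<in>opens X. x \<in> W \<and> W \<subseteq> U \<and> res X U W s \<in> J W"
      using res_res[OF U V(1) W(1) W(3) V(3) sU] V by (intro bexI[of _ W]) auto
  qed
  ultimately show ?thesis
    unfolding ideal_sheaf_def ideal_presheaf_def by blast
qed

lemma ideal_presheaf_prod:
  assumes I: "ideal_presheaf X I" and J: "ideal_presheaf X J"
  shows "ideal_presheaf X (\<lambda>W. ideal_prod (sec X W) (I W) (J W))"
  unfolding ideal_presheaf_def
proof (intro conjI ballI impI)
  fix U assume U: "U \<in> opens X"
  interpret cring "sec X U" by (rule cring_sec[OF U])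
  show "ideal (ideal_prod (sec X U) (I U) (J U)) (sec X U)"
    using I J U by (intro ideal_prod_is_ideal) (auto simp: ideal_presheaf_def)
next
  fix U V assume U: "U \<in> opens X" and V: "V \<in> opens X" "V \<subseteq> U"
  interpret r: ring_hom_cring "sec X U" "sec X V" "res X U V"
    by (rule res_ring_hom[OF U V])
  interpret I: ideal "I U" "sec X U" using I U by (simp add: ideal_presheaf_def)
  interpret J: ideal "J U" "sec X U" using J U by (simp add: ideal_presheaf_def)
  have sub: "res X U V ` I U \<subseteq> I V" "res X U V ` J U \<subseteq> J V"
    using I J U V by (auto simp: ideal_presheaf_def)
  have "s \<in> carrier (sec X U) \<and> res X U V s \<in> ideal_prod (sec X V) (I V) (J V)"
    if "s \<in> ideal_prod (sec X U) (I U) (J U)" for s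
    using that
  proof (induction rule: ideal_prod.induct)
    case (prod i j)
    then show ?case using sub by (auto intro!: ideal_prod.prod)
  next
    case (sum s1 s2)
    then show ?case by (auto intro!: ideal_prod.sum)
  qed
  then show "res X U V ` ideal_prod (sec X U) (I U) (J U) \<subseteq> ideal_prod (sec X V) (I V) (J V)"
    by blast
qed

end

locale ideal_sheaf_on = ringed_cspace +
  fixes I :: "'a set \<Rightarrow> 'b set"
  assumes sheaf_I: "ideal_sheaf X I"
begin

abbreviation P :: "nat \<Rightarrow> 'a set \<Rightarrow> 'b set" where "P \<equiv> ideal_power X I"

lemma ideal_sheaf_power: "ideal_sheaf X (P k)"
proof (induction k)
  case (Suc k)
  with sheaf_I show ?case
    by (auto simp: ideal_sheaf_prod_eq ideal_sheaf_def[of X I] ideal_sheaf_def[of X "P k"]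
        intro!: ideal_sheaf_locally_in ideal_presheaf_prod)
qed (simp add: sheaf_I)

lemma ideal_power_ideal: "U \<in> opens X \<Longrightarrow> ideal (P k U) (sec X U)"
  using ideal_sheaf_power by (simp add: ideal_sheaf_def ideal_presheaf_def)

lemma ideal_power_closed: "U \<in> opens X \<Longrightarrow> s \<in> P k U \<Longrightarrow> s \<in> carrier (sec X U)"
  using ideal.Icarr[OF ideal_power_ideal] .

lemma res_ideal_power:
  "U \<in> opens X \<Longrightarrow> V \<in> opens X \<Longrightarrow> V \<subseteq> U \<Longrightarrow> s \<in> P k U \<Longrightarrow> res X U V s \<in> P k V"
  using ideal_sheaf_power unfolding ideal_sheaf_def ideal_presheaf_def by blast

lemma ideal_power_local:
  assumes "U \<in> opens X" "s \<in> carrier (sec X U)"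
    "\<And>x. x \<in> U \<Longrightarrow> \<exists>W\<in>opens X. x \<in> W \<and> W \<subseteq> U \<and> res X U W s \<in> P k W"
  shows "s \<in> P k U"
proof -
  have "s \<in> locally_in X (P k) U" using assms by (simp add: locally_in_def)
  then show ?thesis
    using ideal_sheaf_power assms(1) by (auto simp: ideal_sheaf_def)
qed

text \<open>To show that an additive operation, compatible with restrictions, sends a power of \<open>I\<close> into
  another one, it suffices to look at products of sections: locally every section is a sum of
  products, and membership in the target is a local condition.\<close>

lemma ideal_power_Suc_induct:
  assumes U: "U \<in> opens X" and s: "s \<in> P (Suc k) U"
    and f: "\<And>W. W \<in> opens X \<Longrightarrow> W \<subseteq> U \<Longrightarrow> f W \<in> carrier (sec X W) \<rightarrow> carrier (sec X W)"
    and add: "\<And>W a b. W \<in> opens X \<Longrightarrow> W \<subseteq> U \<Longrightarrow> a \<in> carrier (sec X W) \<Longrightarrow> b \<in> carrier (sec X W) \<Longrightarrow>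
        f W (a \<oplus>\<^bsub>sec X W\<^esub> b) = f W a \<oplus>\<^bsub>sec X W\<^esub> f W b"
    and res: "\<And>W a. W \<in> opens X \<Longrightarrow> W \<subseteq> U \<Longrightarrow> a \<in> carrier (sec X U) \<Longrightarrow>
        f W (res X U W a) = res X U W (f U a)"
    and prod: "\<And>W a b. W \<in> opens X \<Longrightarrow> W \<subseteq> U \<Longrightarrow> a \<in> I W \<Longrightarrow> b \<in> P k W \<Longrightarrow>
        f W (a \<otimes>\<^bsub>sec X W\<^esub> b) \<in> P l W"
  shows "f U s \<in> P l U"
proof (rule ideal_power_local[OF U])
  have sU: "s \<in> carrier (sec X U)" using ideal_power_closed[OF U s] .
  then show "f U s \<in> carrier (sec X U)" using f[OF U] by auto
  fix x assume "x \<in> U"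
  with s obtain W where W: "W \<in> opens X" "x \<in> W" "W \<subseteq> U"
      and r: "res X U W s \<in> ideal_prod (sec X W) (I W) (P k W)"
    by (auto simp: ideal_sheaf_prod_def)
  interpret W: cring "sec X W" by (rule cring_sec[OF W(1)])
  interpret Pl: ideal "P l W" "sec X W" by (rule ideal_power_ideal[OF W(1)])
  have mem: "t \<in> carrier (sec X W) \<and> f W t \<in> P l W" if "t \<in> ideal_prod (sec X W) (I W) (P k W)" for t
    using that
  proof (induction rule: ideal_prod.induct)
    case (prod i j)
    then show ?case
      using assms(6)[OF W(1,3)] ideal_power_closed[OF W(1), of i 0] ideal_power_closed[OF W(1), of j k] by simp
  next
    case (sum a b)
    then show ?case using add[OF W(1,3)] by simp
  qed
  have "res X U W (f U s) \<in> P l W"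
    using mem[OF r] res[OF W(1,3) sU] by simp
  with W show "\<exists>W\<in>opens X. x \<in> W \<and> W \<subseteq> U \<and> res X U W (f U s) \<in> P l W" by blast
qed

text \<open>Induction on the first exponent, by associativity: \<open>(i a) b = i (a b)\<close>. Because of the shifted
  index, the exponents \<open>j + 1\<close> and \<open>k + 1\<close> add up to the index \<open>j + k + 1\<close>.\<close>

lemma ideal_power_mult:
  "U \<in> opens X \<Longrightarrow> a \<in> P j U \<Longrightarrow> b \<in> P k U \<Longrightarrow> a \<otimes>\<^bsub>sec X U\<^esub> b \<in> P (Suc (j + k)) U"
proof (induction j arbitrary: U a b)
  case 0
  interpret U: cring "sec X U" by (rule cring_sec[OF 0(1)])
  have "a \<otimes>\<^bsub>sec X U\<^esub> b \<in> carrier (sec X U)"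
    using ideal_power_closed[OF 0(1,2)] ideal_power_closed[OF 0(1,3)] by simp
  moreover from this have "res X U U (a \<otimes>\<^bsub>sec X U\<^esub> b) \<in> ideal_prod (sec X U) (I U) (P k U)"
    using 0 by (auto simp: res_id intro: ideal_prod.prod)
  ultimately show ?case
    using 0(1) by (auto simp: ideal_sheaf_prod_def)
next
  case (Suc j)
  note U = Suc.prems(1)
  have bU: "b \<in> carrier (sec X U)" using ideal_power_closed[OF U Suc.prems(3)] .
  have "a \<otimes>\<^bsub>sec X U\<^esub> res X U U b \<in> P (Suc (Suc j + k)) U"
  proof (rule ideal_power_Suc_induct[OF U Suc.prems(2), where f = "\<lambda>W s. s \<otimes>\<^bsub>sec X W\<^esub> res X U W b"])
    fix W assume W: "W \<in> opens X" "W \<subseteq> U"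
    interpret W: cring "sec X W" by (rule cring_sec[OF W(1)])
    interpret r: ring_hom_cring "sec X U" "sec X W" "res X U W" by (rule res_ring_hom[OF U W])
    have b: "res X U W b \<in> carrier (sec X W)" using bU by simp
    show "(\<lambda>s. s \<otimes>\<^bsub>sec X W\<^esub> res X U W b) \<in> carrier (sec X W) \<rightarrow> carrier (sec X W)"
      using b by auto
    show "(s \<oplus>\<^bsub>sec X W\<^esub> t) \<otimes>\<^bsub>sec X W\<^esub> res X U W b
        = s \<otimes>\<^bsub>sec X W\<^esub> res X U W b \<oplus>\<^bsub>sec X W\<^esub> t \<otimes>\<^bsub>sec X W\<^esub> res X U W b"
      if "s \<in> carrier (sec X W)" "t \<in> carrier (sec X W)" for s t
      using that b by (simp add: W.l_distr)
    show "res X U W s \<otimes>\<^bsub>sec X W\<^esub> res X U W b = res X U W (s \<otimes>\<^bsub>sec X U\<^esub> res X U U b)"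
      if "s \<in> carrier (sec X U)" for s
      using that bU by (simp add: res_id[OF U])
    fix i t assume it: "i \<in> I W" "t \<in> P j W"
    have "t \<otimes>\<^bsub>sec X W\<^esub> res X U W b \<in> P (Suc (j + k)) W"
      using Suc.IH[OF W(1) it(2) res_ideal_power[OF U W Suc.prems(3)]] .
    then have "i \<otimes>\<^bsub>sec X W\<^esub> (t \<otimes>\<^bsub>sec X W\<^esub> res X U W b) \<in> P (Suc (Suc j + k)) W"
    proof -
      assume m: "t \<otimes>\<^bsub>sec X W\<^esub> res X U W b \<in> P (Suc (j + k)) W"
      have "i \<otimes>\<^bsub>sec X W\<^esub> (t \<otimes>\<^bsub>sec X W\<^esub> res X U W b) \<in> carrier (sec X W)"
        using ideal_power_closed[OF W(1), of i 0] it ideal_power_closed[OF W(1) m] by simp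
      then show ?thesis
        using W m it by (subst add_Suc, subst ideal_power.simps(2))
          (auto simp: ideal_sheaf_prod_def res_id intro!: bexI[of _ W] ideal_prod.prod)
    qed
    then show "i \<otimes>\<^bsub>sec X W\<^esub> t \<otimes>\<^bsub>sec X W\<^esub> res X U W b \<in> P (Suc (Suc j + k)) W"
      using it b ideal_power_closed[OF W(1), of i 0] ideal_power_closed[OF W(1) it(2)]
      by (simp add: W.m_assoc del: ideal_power.simps(2))
  qed
  then show ?case by (simp only: res_id[OF U bU])
qed

lemma ideal_power_decreasing:
  assumes U: "U \<in> opens X" shows "P (Suc k) U \<subseteq> P k U"
proof
  fix s assume s: "s \<in> P (Suc k) U"
  show "s \<in> P k U"
  proof (rule ideal_power_Suc_induct[OF U s, where f = "\<lambda>_ s. s"])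
    fix W a b assume W: "W \<in> opens X" and a: "a \<in> I W" and b: "b \<in> P k W"
    have "a \<in> carrier (sec X W)" using ideal_power_closed[OF W, of a 0] a by simp
    then show "a \<otimes>\<^bsub>sec X W\<^esub> b \<in> P k W"
      using ideal.I_l_closed[OF ideal_power_ideal[OF W] b] by simp
  qed auto
qed

lemma ideal_power_antimono:
  assumes "U \<in> opens X" "k \<le> j" shows "P j U \<subseteq> P k U"
  using assms(2)
proof (induction j rule: dec_induct)
  case (step j)
  with ideal_power_decreasing[OF assms(1), of j] show ?case by blast
qed auto

end

text \<open>The twisted Leibniz rule with the factor \<open>\<epsilon>\<close> covers derivations (\<open>\<epsilon> = 0\<close>) and the differences
  \<open>\<phi> - 1\<close> for ring homomorphisms \<open>\<phi>\<close> (\<open>\<epsilon> = 1\<close>), so that the existence and the uniqueness of the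
  logarithm rest on the same nilpotency argument.\<close>

locale ideal_raising = ideal_sheaf_on X I
  for X :: "('p, 'r) cspace" and I :: "'p set \<Rightarrow> 'r set" +
  fixes T :: "'p set \<Rightarrow> 'r \<Rightarrow> 'r" and \<epsilon> :: "'p set \<Rightarrow> 'r"
  assumes T_add: "U \<in> opens X \<Longrightarrow> s \<in> carrier (sec X U) \<Longrightarrow> t \<in> carrier (sec X U) \<Longrightarrow>
        T U (s \<oplus>\<^bsub>sec X U\<^esub> t) = T U s \<oplus>\<^bsub>sec X U\<^esub> T U t"
    and T_res: "U \<in> opens X \<Longrightarrow> V \<in> opens X \<Longrightarrow> V \<subseteq> U \<Longrightarrow> s \<in> carrier (sec X U) \<Longrightarrow>
        T V (res X U V s) = res X U V (T U s)"
    and T_mult: "U \<in> opens X \<Longrightarrow> s \<in> carrier (sec X U) \<Longrightarrow> t \<in> carrier (sec X U) \<Longrightarrow>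
        T U (s \<otimes>\<^bsub>sec X U\<^esub> t) = s \<otimes>\<^bsub>sec X U\<^esub> T U t \<oplus>\<^bsub>sec X U\<^esub> t \<otimes>\<^bsub>sec X U\<^esub> T U s
          \<oplus>\<^bsub>sec X U\<^esub> \<epsilon> U \<otimes>\<^bsub>sec X U\<^esub> (T U s \<otimes>\<^bsub>sec X U\<^esub> T U t)"
    and \<epsilon>_closed: "U \<in> opens X \<Longrightarrow> \<epsilon> U \<in> carrier (sec X U)"
    and T_ideal: "U \<in> opens X \<Longrightarrow> s \<in> carrier (sec X U) \<Longrightarrow> T U s \<in> I U"
    and T_square: "U \<in> opens X \<Longrightarrow> s \<in> I U \<Longrightarrow> T U s \<in> P 1 U"
begin

text \<open>Locally a section of the next power is a sum of products \<open>a b\<close> with \<open>a\<close> in \<open>I\<close> and \<open>b\<close> in the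
  previous power, and each of the three terms of the twisted Leibniz rule for \<open>a b\<close> lies one power
  deeper than \<open>a b\<close>.\<close>

lemma T_ideal_power: "U \<in> opens X \<Longrightarrow> s \<in> P k U \<Longrightarrow> T U s \<in> P (Suc k) U"
proof (induction k arbitrary: U s)
  case 0
  then show ?case using T_square by simp
next
  case (Suc k)
  show ?case
  proof (rule ideal_power_Suc_induct[OF Suc.prems])
    fix W assume W: "W \<in> opens X" "W \<subseteq> U"
    show "T W \<in> carrier (sec X W) \<rightarrow> carrier (sec X W)"
      using T_ideal[OF W(1)] ideal_power_closed[OF W(1), of _ 0] by auto
    fix a b assume a: "a \<in> I W" and b: "b \<in> P k W"
    interpret Q: ideal "P (Suc (Suc k)) W" "sec X W" by (rule ideal_power_ideal[OF W(1)])
    have Ta: "T W a \<in> P 1 W" and Tb: "T W b \<in> P (Suc k) W"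
      using T_square[OF W(1) a] Suc.IH[OF W(1) b] .
    have c: "a \<in> carrier (sec X W)" "b \<in> carrier (sec X W)"
      using ideal_power_closed[OF W(1), of a 0] ideal_power_closed[OF W(1) b] a by auto
    have "a \<otimes>\<^bsub>sec X W\<^esub> T W b \<in> P (Suc (Suc k)) W"
      using ideal_power_mult[OF W(1) _ Tb, of a 0] a by simp
    moreover have "b \<otimes>\<^bsub>sec X W\<^esub> T W a \<in> P (Suc (Suc k)) W"
      using ideal_power_mult[OF W(1) b Ta] by simp
    moreover have "T W a \<otimes>\<^bsub>sec X W\<^esub> T W b \<in> P (Suc (Suc k)) W"
      using ideal_power_mult[OF W(1) _ Tb, of "T W a" 0] T_ideal[OF W(1) c(1)] by simp
    ultimately show "T W (a \<otimes>\<^bsub>sec X W\<^esub> b) \<in> P (Suc (Suc k)) W"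
      unfolding T_mult[OF W(1) c] using \<epsilon>_closed[OF W(1)]
      by (simp add: Q.I_l_closed del: ideal_power.simps)
  qed (use Suc.prems T_add T_res in auto)
qed

lemma T_iterate_ideal: "U \<in> opens X \<Longrightarrow> s \<in> I U \<Longrightarrow> (T U ^^ k) s \<in> P k U"
  by (induction k) (auto intro: T_ideal_power simp del: ideal_power.simps(2))

lemma T_iterate: "U \<in> opens X \<Longrightarrow> s \<in> carrier (sec X U) \<Longrightarrow> (T U ^^ Suc k) s \<in> P k U"
  by (induction k) (auto intro: T_ideal T_ideal_power simp del: ideal_power.simps(2))

end

section \<open>The ideal sheaf of the reduced curve is nilpotent\<close>

lemma pre_eq:
  "(\<And>x. x \<in> points X \<Longrightarrow> f x = x) \<Longrightarrow> V \<subseteq> points X \<Longrightarrow> pre X f V = V"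
  by (auto simp: pre_def)

locale multiple_curve =
  fixes n :: nat and C :: "('p, 's) cspace" and X :: "('p, 'r) cspace"
    and \<pi> :: "'p set \<Rightarrow> 'r \<Rightarrow> 's"
  assumes curve: "primitive_multiple_curve n C X \<pi>" and ringed_C: "ringed_space C"
    and n_pos: "n > 0"
begin

sublocale C: ringed_cspace C
  by unfold_locales (rule ringed_C)

sublocale ringed_cspace X
  using curve by unfold_locales (simp add: primitive_multiple_curve_def scheme_over_complex_def)

lemma top_eq: "top_of C = top_of X"
  using curve by (simp add: primitive_multiple_curve_def)

lemma pi_morphism: "ringed_morphism C X (id, \<pi>)"
  using curve by (simp add: primitive_multiple_curve_def closed_immersion_def morphism_def)

lemma pre_C [simp]: "U \<in> opens X \<Longrightarrow> pre C id U = U"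
  by (rule pre_eq) (auto simp: top_eq dest: openin_subset)

lemma pi_ring_hom: "U \<in> opens X \<Longrightarrow> ring_hom_cring (sec X U) (sec C U) (\<pi> U)"
  using pi_morphism cring_sec C.cring_sec pre_C
  by (simp add: ringed_morphism_def top_eq ring_hom_cring_def ring_hom_cring_axioms_def)

lemma pi_res:
  "U \<in> opens X \<Longrightarrow> V \<in> opens X \<Longrightarrow> V \<subseteq> U \<Longrightarrow> s \<in> carrier (sec X U) \<Longrightarrow>
     \<pi> V (res X U V s) = res C U V (\<pi> U s)"
  using pi_morphism pre_C by (simp add: ringed_morphism_def)

abbreviation \<I> :: "'p set \<Rightarrow> 'r set" where "\<I> \<equiv> curve_ideal C X \<pi>"

lemma mem_curve_ideal: "s \<in> \<I> U \<longleftrightarrow> s \<in> carrier (sec X U) \<and> \<pi> U s = \<zero>\<^bsub>sec C U\<^esub>"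
  by (auto simp: curve_ideal_def a_kernel_def')

text \<open>The kernel is a sheaf because vanishing of a section on \<open>C\<close> can be tested locally.\<close>

lemma ideal_sheaf_curve_ideal: "ideal_sheaf X \<I>"
  unfolding ideal_sheaf_def ideal_presheaf_def
proof (intro conjI ballI impI)
  fix U assume U: "U \<in> opens X"
  interpret p: ring_hom_cring "sec X U" "sec C U" "\<pi> U" by (rule pi_ring_hom[OF U])
  show "ideal (\<I> U) (sec X U)"
    unfolding curve_ideal_def
    by (rule ring_hom_ring.kernel_is_ideal) (rule ring_hom_ringI2[OF p.R.ring_axioms p.S.ring_axioms p.homh])
next
  fix U V assume U: "U \<in> opens X" and V: "V \<in> opens X" "V \<subseteq> U"
  interpret r: ring_hom_cring "sec C U" "sec C V" "res C U V"
    by (rule C.res_ring_hom) (use U V top_eq in auto)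
  show "res X U V ` \<I> U \<subseteq> \<I> V"
    using U V by (auto simp: mem_curve_ideal pi_res res_closed)
next
  fix U assume U: "U \<in> opens X"
  interpret p: ring_hom_cring "sec X U" "sec C U" "\<pi> U" by (rule pi_ring_hom[OF U])
  show "locally_in X \<I> U \<subseteq> \<I> U"
  proof
    fix s assume s: "s \<in> locally_in X \<I> U"
    then have sU: "s \<in> carrier (sec X U)" by (simp add: locally_in_def)
    have "\<pi> U s = \<zero>\<^bsub>sec C U\<^esub>"
    proof (rule C.eq_if_locally_eq)
      fix x assume "x \<in> U"
      with s obtain W where W: "W \<in> opens X" "x \<in> W" "W \<subseteq> U" "res X U W s \<in> \<I> W"
        unfolding locally_in_def by blast
      interpret r: ring_hom_cring "sec C U" "sec C W" "res C U W"
        by (rule C.res_ring_hom) (use U W top_eq in auto)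
      show "\<exists>W\<in>opens C. x \<in> W \<and> W \<subseteq> U \<and> res C U W (\<pi> U s) = res C U W \<zero>\<^bsub>sec C U\<^esub>"
        using W pi_res[OF U W(1,3) sU] by (intro bexI[of _ W]) (auto simp: mem_curve_ideal top_eq)
    qed (use U sU top_eq in auto)
    with sU show "s \<in> \<I> U" by (simp add: mem_curve_ideal)
  qed
qed

sublocale ideal_sheaf_on X \<I>
  by unfold_locales (rule ideal_sheaf_curve_ideal)

lemma chart_restriction:
  assumes U: "U \<in> opens X"
    and chart: "isomorphism (restrict_space (thicken n C) U) (restrict_space X U) (id, \<psi>)"
    and W: "W \<in> opens X" "W \<subseteq> U"
  shows chart_ring_iso: "\<psi> W \<in> ring_iso (sec X W) (trunc_poly_ring n (sec C W))"
    and chart_res: "V \<in> opens X \<Longrightarrow> V \<subseteq> W \<Longrightarrow> s \<in> carrier (sec X W) \<Longrightarrow>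
      \<psi> V (res X W V s) k = res C W V (\<psi> W s k)"
proof -
  have pre: "pre (restrict_space (thicken n C) U) id V = V" if "V \<in> opens X" "V \<subseteq> U" for V
    using that openin_subset[of "top_of X" V] by (intro pre_eq) (auto simp: restrict_space_def thicken_def top_eq)
  have opens: "V \<in> opens (restrict_space X U) \<longleftrightarrow> V \<in> opens X \<and> V \<subseteq> U" for V
    using U by (simp add: restrict_space_def openin_open_subtopology)
  have iso: "\<And>V. V \<in> opens (restrict_space X U) \<Longrightarrow>
      \<psi> V \<in> ring_iso (sec (restrict_space X U) V)
        (sec (restrict_space (thicken n C) U) (pre (restrict_space (thicken n C) U) id V))"
    and nat: "\<And>V W s. V \<in> opens (restrict_space X U) \<Longrightarrow> W \<in> opens (restrict_space X U) \<Longrightarrow> W \<subseteq> V \<Longrightarrow>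
      s \<in> carrier (sec (restrict_space X U) V) \<Longrightarrow>
      \<psi> W (res (restrict_space X U) V W s) = res (restrict_space (thicken n C) U)
        (pre (restrict_space (thicken n C) U) id V) (pre (restrict_space (thicken n C) U) id W) (\<psi> V s)"
    using chart unfolding isomorphism_def ringed_morphism_def by auto
  show "\<psi> W \<in> ring_iso (sec X W) (trunc_poly_ring n (sec C W))"
    using iso[OF opens[THEN iffD2, OF conjI[OF W]]] W by (simp add: pre) (simp add: restrict_space_def thicken_def)
  show "\<psi> V (res X W V s) k = res C W V (\<psi> W s k)"
    if "V \<in> opens X" "V \<subseteq> W" "s \<in> carrier (sec X W)"
  proof -
    have "V \<subseteq> U" using that W by blast
    then show ?thesis
      using nat[of W V s] W that U
      by (simp add: opens pre) (simp add: restrict_space_def thicken_def openin_open_subtopology)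
  qed
qed

text \<open>In a chart the sections of the ideal sheaf are the multiples of \<open>t\<close>, so the sections of its power
  of exponent \<open>k + 1\<close> are multiples of \<open>t\<^sup>k\<^sup>+\<^sup>1\<close>.\<close>

lemma chart_coeff_zero:
  assumes U: "U \<in> opens X"
    and chart: "isomorphism (restrict_space (thicken n C) U) (restrict_space X U) (id, \<psi>)"
    and \<psi>_0: "\<And>W s. W \<in> opens X \<Longrightarrow> W \<subseteq> U \<Longrightarrow> s \<in> carrier (sec X W) \<Longrightarrow> \<psi> W s 0 = \<pi> W s"
    and W: "W \<in> opens X" "W \<subseteq> U" and s: "s \<in> P k W" and i: "i \<le> k"
  shows "\<psi> W s i = \<zero>\<^bsub>sec C W\<^esub>"
  using W s i
proof (induction k arbitrary: W s i)
  case 0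
  then show ?case by (simp add: mem_curve_ideal \<psi>_0)
next
  case (Suc k)
  note W = Suc.prems(1,2)
  have \<psi>_closed: "\<psi> V t j \<in> carrier (sec C V)"
    if "V \<in> opens X" "V \<subseteq> U" "t \<in> carrier (sec X V)" for V t j
    using chart_ring_iso[OF U chart that(1,2)] that(3)
    by (auto simp: ring_iso_def trunc_poly_ring_def dest!: ring_hom_closed)
  have sW: "s \<in> carrier (sec X W)" using ideal_power_closed[OF W(1) Suc.prems(3)] .
  interpret CW: cring "sec C W" by (rule C.cring_sec) (use W top_eq in auto)
  show ?case
  proof (rule C.eq_if_locally_eq)
    fix x assume "x \<in> W"
    with Suc.prems(3) obtain V where V: "V \<in> opens X" "x \<in> V" "V \<subseteq> W"
        and r: "res X W V s \<in> ideal_prod (sec X V) (\<I> V) (P k V)"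
      by (auto simp: ideal_sheaf_prod_def)
    have VU: "V \<subseteq> U" using V W by blast
    interpret XV: cring "sec X V" by (rule cring_sec[OF V(1)])
    interpret CV: cring "sec C V" by (rule C.cring_sec) (use V top_eq in auto)
    interpret h: ring_hom_cring "sec C W" "sec C V" "res C W V"
      by (rule C.res_ring_hom) (use W V top_eq in auto)
    have hom: "\<psi> V \<in> ring_hom (sec X V) (trunc_poly_ring n (sec C V))"
      using chart_ring_iso[OF U chart V(1) VU] by (simp add: ring_iso_def)
    have zero: "t \<in> carrier (sec X V) \<and> (\<forall>i\<le>Suc k. \<psi> V t i = \<zero>\<^bsub>sec C V\<^esub>)"
      if "t \<in> ideal_prod (sec X V) (\<I> V) (P k V)" for t
      using that
    proof (induction rule: ideal_prod.induct)
      case (prod a b)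
      have a: "a \<in> carrier (sec X V)" "\<psi> V a 0 = \<zero>\<^bsub>sec C V\<^esub>"
        using prod(1) V(1) VU \<psi>_0 by (auto simp: mem_curve_ideal)
      have b: "b \<in> carrier (sec X V)" using ideal_power_closed[OF V(1) prod(2)] .
      have "\<psi> V (a \<otimes>\<^bsub>sec X V\<^esub> b) i = \<zero>\<^bsub>sec C V\<^esub>" if "i \<le> Suc k" for i
      proof -
        have "\<psi> V a j \<otimes>\<^bsub>sec C V\<^esub> \<psi> V b (i - j) = \<zero>\<^bsub>sec C V\<^esub>" for j
        proof (cases j)
          case 0
          then show ?thesis using a(2) \<psi>_closed[OF V(1) VU b] by simp
        next
          case (Suc j')
          then have "\<psi> V b (i - j) = \<zero>\<^bsub>sec C V\<^esub>"
            using that by (intro Suc.IH[OF V(1) VU prod(2)]) auto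
          then show ?thesis using \<psi>_closed[OF V(1) VU a(1)] by simp
        qed
        then show ?thesis
          using ring_hom_mult[OF hom a(1) b] by (simp add: trunc_poly_ring_def)
      qed
      with a b show ?case by simp
    next
      case (sum a b)
      then show ?case
        using ring_hom_add[OF hom, of a b] by (simp add: trunc_poly_ring_def)
    qed
    show "\<exists>V\<in>opens C. x \<in> V \<and> V \<subseteq> W \<and> res C W V (\<psi> W s i) = res C W V \<zero>\<^bsub>sec C W\<^esub>"
      using V Suc.prems(4) zero[OF r] chart_res[OF U chart W V(1,3) sW, of i, symmetric]
      by (intro bexI[of _ V]) (auto simp: top_eq)
  qed (use W sW \<psi>_closed top_eq in auto)
qed

text \<open>In the charts \<open>t\<^sup>n = 0\<close>, and a section that vanishes on all charts is zero.\<close>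

lemma ideal_power_eq_zero:
  assumes W: "W \<in> opens X" and s: "s \<in> P (n - 1) W"
  shows "s = \<zero>\<^bsub>sec X W\<^esub>"
proof -
  obtain \<U> \<psi> where cover: "\<U> \<subseteq> opens C" "\<Union>\<U> = points C"
    and chart: "\<And>U. U \<in> \<U> \<Longrightarrow>
      isomorphism (restrict_space (thicken n C) U) (restrict_space X U) (id, \<psi> U)"
    and \<psi>_0: "\<And>U W s. U \<in> \<U> \<Longrightarrow> W \<in> opens X \<Longrightarrow> W \<subseteq> U \<Longrightarrow> s \<in> carrier (sec X W) \<Longrightarrow>
      \<psi> U W s 0 = \<pi> W s"
    using curve unfolding primitive_multiple_curve_def gluing_def by metis
  interpret XW: cring "sec X W" by (rule cring_sec[OF W])
  show ?thesis
  proof (rule eq_if_locally_eq[OF W])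
    show "s \<in> carrier (sec X W)" using ideal_power_closed[OF W s] .
    fix x assume x: "x \<in> W"
    then have "x \<in> points C" using W top_eq openin_subset by fastforce
    with cover obtain U where UU: "U \<in> \<U>" "x \<in> U" by blast
    then have U: "U \<in> opens X" using cover top_eq by auto
    let ?V = "U \<inter> W"
    have V: "?V \<in> opens X" "?V \<subseteq> U" using U W by auto
    interpret r: ring_hom_cring "sec X W" "sec X ?V" "res X W ?V"
      by (rule res_ring_hom[OF W V(1)]) auto
    have t: "res X W ?V s \<in> P (n - 1) ?V" using res_ideal_power[OF W V(1) _ s] by simp
    \<comment> \<open>Zero is treated like \<open>s\<close>: equality of the two images then suffices, by injectivity.\<close>
    have Z: "\<zero>\<^bsub>sec X ?V\<^esub> \<in> P (n - 1) ?V"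
      by (rule additive_subgroup.zero_closed[OF ideal.axioms(1)[OF ideal_power_ideal[OF V(1)]]])
    have iso: "\<psi> U ?V \<in> ring_iso (sec X ?V) (trunc_poly_ring n (sec C ?V))"
      by (rule chart_ring_iso[OF U chart[OF UU(1)] V])
    have coeff: "\<psi> U ?V t i = \<zero>\<^bsub>sec C ?V\<^esub>" if t: "t \<in> P (n - 1) ?V" for t i
    proof (cases "i < n")
      case True
      then show ?thesis
        by (intro chart_coeff_zero[OF U chart[OF UU(1)] \<psi>_0[OF UU(1)] V t]) auto
    next
      case False
      have "t \<in> carrier (sec X ?V)" using ideal_power_closed[OF V(1) t] .
      then have "\<psi> U ?V t \<in> carrier (trunc_poly_ring n (sec C ?V))"
        using iso by (auto simp: ring_iso_def dest: ring_hom_closed)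
      with False show ?thesis by (simp add: trunc_poly_ring_def)
    qed
    have "\<psi> U ?V (res X W ?V s) = \<psi> U ?V \<zero>\<^bsub>sec X ?V\<^esub>"
      using coeff[OF t] coeff[OF Z] by (simp add: fun_eq_iff)
    moreover have "inj_on (\<psi> U ?V) (carrier (sec X ?V))"
      using iso by (simp add: ring_iso_def bij_betw_def)
    ultimately have "res X W ?V s = \<zero>\<^bsub>sec X ?V\<^esub>"
      using ideal_power_closed[OF V(1) t] ideal_power_closed[OF V(1) Z] by (auto dest: inj_onD)
    then show "\<exists>V\<in>opens X. x \<in> V \<and> V \<subseteq> W \<and> res X W V s = res X W V \<zero>\<^bsub>sec X W\<^esub>"
      using x UU V by (intro bexI[of _ ?V]) auto
  qed simp
qed

end

section \<open>Existence and uniqueness of the logarithm\<close>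

context multiple_curve begin

lemma nilpotent_op_if_ideal_raising:
  assumes "ideal_raising X \<I> T \<epsilon>" and U: "U \<in> opens X"
    and scale: "\<And>c s. s \<in> carrier (sec X U) \<Longrightarrow>
      T U (scal X U c \<otimes>\<^bsub>sec X U\<^esub> s) = scal X U c \<otimes>\<^bsub>sec X U\<^esub> T U s"
  shows "nilpotent_op (sec X U) (scal X U) (T U) n"
proof -
  interpret T: ideal_raising X \<I> T \<epsilon> by fact
  interpret complex_algebra "sec X U" "scal X U" by (rule complex_algebra_sec[OF U])
  show ?thesis
  proof unfold_locales
    fix s assume s: "s \<in> carrier (sec X U)"
    show "T U s \<in> carrier (sec X U)"
      using T.T_ideal[OF U s] by (simp add: mem_curve_ideal)
    show "(T U ^^ n) s = \<zero>\<^bsub>sec X U\<^esub>"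
      using T.T_iterate[OF U s, of "n - 1"] n_pos by (intro ideal_power_eq_zero[OF U]) simp
  qed (use T.T_add[OF U] scale in auto)
qed

end

theorem mainTheorem12:
  fixes C :: "('p, 's) cspace"
    and Cn :: "('p, 'r) cspace"
    and \<pi> :: "'p set \<Rightarrow> 'r \<Rightarrow> 's"
    and \<phi> :: "('p, 'r, 'p, 'r) mor"
    and n :: nat
  assumes "n \<ge> 2"
    and "smooth_projective_curve C"
    and "primitive_multiple_curve n C Cn \<pi>"
    and "\<phi> \<in> Aut0_C C Cn \<pi>"
  shows "\<exists>!D. D \<in> ideal_derivations C Cn \<pi> (points Cn) \<and> mor_eq Cn Cn \<phi> (chi Cn D)"
proof -
  interpret multiple_curve n C Cn \<pi>
    using assms by unfold_locales (auto simp: smooth_projective_curve_def scheme_over_complex_def)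
  obtain f \<Phi> where \<phi>: "\<phi> = (f, \<Phi>)" by (cases \<phi>)
  have "(f, \<Phi>) \<in> Aut_C C Cn \<pi>"
    and L: "\<And>U s. U \<in> opens Cn \<Longrightarrow> s \<in> \<I> U \<Longrightarrow>
      curve_ideal_square C Cn \<pi> U +>\<^bsub>sec Cn U\<^esub> \<Phi> U s = curve_ideal_square C Cn \<pi> U +>\<^bsub>sec Cn U\<^esub> s"
    using assms(4) by (auto simp: Aut0_C_def \<phi>)
  then have mor: "ringed_morphism Cn Cn (f, \<Phi>)"
    and C: "mor_eq C Cn (mor_comp Cn (f, \<Phi>) (id, \<pi>)) (id, \<pi>)"
    by (auto simp: Aut_C_def isomorphism_def)
  \<comment> \<open>The reduced curve has the same points, so \<open>\<phi>\<close> is the identity on points and acts on the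
    sections over each open set.\<close>
  have f: "f x = x" if "x \<in> points Cn" for x
    using C that by (simp add: mor_eq_def mor_comp_def top_eq)
  have pre: "pre Cn f U = U" if "U \<in> opens Cn" for U
    using that f by (intro pre_eq) (auto dest: openin_subset)
  have \<Phi>_hom: "\<Phi> U \<in> ring_hom (sec Cn U) (sec Cn U)" if "U \<in> opens Cn" for U
    using mor that pre[OF that] by (auto simp: ringed_morphism_def)
  have \<Phi>_scal: "\<Phi> U (scal Cn U c) = scal Cn U c" if "U \<in> opens Cn" for U c
    using mor that pre[OF that] by (auto simp: ringed_morphism_def)
  have \<Phi>_res: "\<Phi> V (res Cn U V s) = res Cn U V (\<Phi> U s)"
    if "U \<in> opens Cn" "V \<in> opens Cn" "V \<subseteq> U" "s \<in> carrier (sec Cn U)" for U V s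
    using mor that pre[OF that(1)] pre[OF that(2)] by (auto simp: ringed_morphism_def)
  have \<Phi>_pi: "\<pi> U (\<Phi> U s) = \<pi> U s" if "U \<in> opens Cn" "s \<in> carrier (sec Cn U)" for U s
    using C that pre[OF that(1)] by (auto simp: mor_eq_def mor_comp_def)
  have \<Phi>_closed: "\<Phi> U s \<in> carrier (sec Cn U)" if "U \<in> opens Cn" "s \<in> carrier (sec Cn U)" for U s
    using ring_hom_closed[OF \<Phi>_hom] that by blast
  define N where "N U s = \<Phi> U s \<ominus>\<^bsub>sec Cn U\<^esub> s" for U s
  have N_closed: "N U s \<in> carrier (sec Cn U)" if "U \<in> opens Cn" "s \<in> carrier (sec Cn U)" for U s
  proof -
    interpret cring "sec Cn U" by (rule cring_sec[OF that(1)])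
    show ?thesis using that \<Phi>_closed by (simp add: N_def)
  qed
  have \<Phi>_N: "\<Phi> U s = s \<oplus>\<^bsub>sec Cn U\<^esub> N U s" if "U \<in> opens Cn" "s \<in> carrier (sec Cn U)" for U s
  proof -
    interpret cring "sec Cn U" by (rule cring_sec[OF that(1)])
    show ?thesis using that \<Phi>_closed[OF that] unfolding N_def by algebra
  qed
  have N_mult: "s \<otimes>\<^bsub>sec Cn U\<^esub> t \<oplus>\<^bsub>sec Cn U\<^esub> N U (s \<otimes>\<^bsub>sec Cn U\<^esub> t)
      = (s \<oplus>\<^bsub>sec Cn U\<^esub> N U s) \<otimes>\<^bsub>sec Cn U\<^esub> (t \<oplus>\<^bsub>sec Cn U\<^esub> N U t)"
    if "U \<in> opens Cn" "s \<in> carrier (sec Cn U)" "t \<in> carrier (sec Cn U)" for U s t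
  proof -
    interpret cring "sec Cn U" by (rule cring_sec[OF that(1)])
    show ?thesis
      using that ring_hom_mult[OF \<Phi>_hom[OF that(1)] that(2,3)] by (simp add: \<Phi>_N[symmetric])
  qed
  have N_scale: "N U (scal Cn U c \<otimes>\<^bsub>sec Cn U\<^esub> s) = scal Cn U c \<otimes>\<^bsub>sec Cn U\<^esub> N U s"
    if "U \<in> opens Cn" "s \<in> carrier (sec Cn U)" for U c s
  proof -
    interpret complex_algebra "sec Cn U" "scal Cn U" by (rule complex_algebra_sec[OF that(1)])
    have c: "scal Cn U c \<in> carrier (sec Cn U)" by simp
    show ?thesis
      using that c \<Phi>_closed[OF that] unfolding N_def ring_hom_mult[OF \<Phi>_hom[OF that(1)] c that(2)] \<Phi>_scal[OF that(1)]
      by algebra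
  qed
  \<comment> \<open>\<open>\<phi>\<close> fixes the sections of \<open>C\<close>, hence \<open>N\<close> has values in the ideal sheaf; it fixes the classes
    modulo the square of the ideal sheaf, hence \<open>N\<close> sends that sheaf to its square.\<close>
  have N_raising: "ideal_raising Cn \<I> N (\<lambda>U. \<one>\<^bsub>sec Cn U\<^esub>)"
  proof unfold_locales
    fix U assume U: "U \<in> opens Cn"
    interpret cring "sec Cn U" by (rule cring_sec[OF U])
    interpret p: ring_hom_cring "sec Cn U" "sec C U" "\<pi> U" by (rule pi_ring_hom[OF U])
    show "\<one>\<^bsub>sec Cn U\<^esub> \<in> carrier (sec Cn U)" by simp
    fix s assume s: "s \<in> carrier (sec Cn U)"
    show "N U s \<in> \<I> U"
      using \<Phi>_pi[OF U s] \<Phi>_closed[OF U s] s N_closed[OF U s]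
      by (simp add: mem_curve_ideal N_def minus_eq p.S.r_neg)
    fix t assume t: "t \<in> carrier (sec Cn U)"
    show "N U (s \<oplus>\<^bsub>sec Cn U\<^esub> t) = N U s \<oplus>\<^bsub>sec Cn U\<^esub> N U t"
      using s t \<Phi>_closed[OF U] ring_hom_add[OF \<Phi>_hom[OF U] s t] unfolding N_def by algebra
    show "N U (s \<otimes>\<^bsub>sec Cn U\<^esub> t) = s \<otimes>\<^bsub>sec Cn U\<^esub> N U t \<oplus>\<^bsub>sec Cn U\<^esub> t \<otimes>\<^bsub>sec Cn U\<^esub> N U s
        \<oplus>\<^bsub>sec Cn U\<^esub> \<one>\<^bsub>sec Cn U\<^esub> \<otimes>\<^bsub>sec Cn U\<^esub> (N U s \<otimes>\<^bsub>sec Cn U\<^esub> N U t)"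
      using s t \<Phi>_closed[OF U] ring_hom_mult[OF \<Phi>_hom[OF U] s t] unfolding N_def by algebra
  next
    fix U V s assume U: "U \<in> opens Cn" and V: "V \<in> opens Cn" "V \<subseteq> U" and s: "s \<in> carrier (sec Cn U)"
    interpret r: ring_hom_cring "sec Cn U" "sec Cn V" "res Cn U V" by (rule res_ring_hom[OF U V])
    show "N V (res Cn U V s) = res Cn U V (N U s)"
      using s \<Phi>_closed[OF U s] by (simp add: N_def \<Phi>_res[OF U V s] r.R.minus_eq r.S.minus_eq)
  next
    fix U s assume U: "U \<in> opens Cn" and s: "s \<in> \<I> U"
    interpret cring "sec Cn U" by (rule cring_sec[OF U])
    interpret P1: ideal "P 1 U" "sec Cn U" by (rule ideal_power_ideal[OF U])
    have sU: "s \<in> carrier (sec Cn U)" using s by (simp add: mem_curve_ideal)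
    have "curve_ideal_square C Cn \<pi> U = P 1 U" by (simp add: curve_ideal_square_def)
    then have "\<Phi> U s \<in> P 1 U +>\<^bsub>sec Cn U\<^esub> s"
      using L[OF U s] P1.a_rcos_self[OF \<Phi>_closed[OF U sU]] by simp
    then show "N U s \<in> P 1 U"
      using P1.a_rcos_module_imp[OF sU] by (simp add: N_def minus_eq)
  qed
  have N_nilpotent: "nilpotent_op (sec Cn U) (scal Cn U) (N U) n" if "U \<in> opens Cn" for U
    by (rule nilpotent_op_if_ideal_raising[OF N_raising that N_scale[OF that]])
  define \<Lambda> where "\<Lambda> U = complex_algebra.fps_op (sec Cn U) (scal Cn U) n (N U) (fps_ln 1)" for U
  \<comment> \<open>The default values outside the carriers are those required of sections of the sheaf of
    derivations.\<close>
  define D where "D = (\<lambda>U\<in>opens Cn. \<lambda>s\<in>carrier (sec Cn U). \<Lambda> U s)"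
  have exp_iff: "mor_eq Cn Cn \<phi> (chi Cn E) \<longleftrightarrow>
      (\<forall>U\<in>opens Cn. \<forall>s\<in>carrier (sec Cn U).
        complex_algebra.fps_op (sec Cn U) (scal Cn U) n (E U) (fps_exp 1) s = s \<oplus>\<^bsub>sec Cn U\<^esub> N U s)"
    if nilpotent: "\<And>U. U \<in> opens Cn \<Longrightarrow> nilpotent_op (sec Cn U) (scal Cn U) (E U) n" for E
  proof -
    have "exp_derivation Cn E U s = complex_algebra.fps_op (sec Cn U) (scal Cn U) n (E U) (fps_exp 1) s"
      if U: "U \<in> opens Cn" and s: "s \<in> carrier (sec Cn U)" for U s
    proof -
      interpret E: nilpotent_op "sec Cn U" "scal Cn U" "E U" n by (rule nilpotent[OF U])
      show ?thesis
        unfolding exp_derivation_def by (rule E.finsum_support_exp[OF s])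
    qed
    then show ?thesis
      using f by (auto simp: mor_eq_def chi_def \<phi> \<Phi>_N)
  qed
  have sec_D: "nilpotent_op (sec Cn U) (scal Cn U) (D U) n"
    "\<And>s. s \<in> carrier (sec Cn U) \<Longrightarrow>
      complex_algebra.fps_op (sec Cn U) (scal Cn U) n (D U) (fps_exp 1) s = s \<oplus>\<^bsub>sec Cn U\<^esub> N U s"
    "\<And>s t. s \<in> carrier (sec Cn U) \<Longrightarrow> t \<in> carrier (sec Cn U) \<Longrightarrow>
      D U (s \<otimes>\<^bsub>sec Cn U\<^esub> t) = s \<otimes>\<^bsub>sec Cn U\<^esub> D U t \<oplus>\<^bsub>sec Cn U\<^esub> t \<otimes>\<^bsub>sec Cn U\<^esub> D U s"
    if U: "U \<in> opens Cn" for U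
  proof -
    interpret N: nilpotent_op "sec Cn U" "scal Cn U" "N U" n by (rule N_nilpotent[OF U])
    interpret \<Lambda>: nilpotent_op "sec Cn U" "scal Cn U" "\<Lambda> U" n
      unfolding \<Lambda>_def by (rule N.nilpotent_op_ev) simp
    have D: "D U s = \<Lambda> U s" if "s \<in> carrier (sec Cn U)" for s
      using U that by (simp add: D_def)
    show "nilpotent_op (sec Cn U) (scal Cn U) (D U) n"
    proof unfold_locales
      fix s assume s: "s \<in> carrier (sec Cn U)"
      have "(\<Lambda> U ^^ n) s = (D U ^^ n) s"
        by (rule N.power_cong) (use s D in auto)
      then show "(D U ^^ n) s = \<zero>\<^bsub>sec Cn U\<^esub>"
        using \<Lambda>.T_nilpotent[OF s] by simp
    qed (auto simp: D \<Lambda>.T_add \<Lambda>.T_scale)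
    fix s assume s: "s \<in> carrier (sec Cn U)"
    have "N.fps_op n (D U) (fps_exp 1) s = N.fps_op n (\<Lambda> U) (fps_exp 1) s"
      by (rule sym, rule N.fps_op_cong) (use s D in auto)
    also have "\<dots> = s \<oplus>\<^bsub>sec Cn U\<^esub> N U s"
      unfolding \<Lambda>_def by (rule N.exp_ln[OF s])
    finally show "N.fps_op n (D U) (fps_exp 1) s = s \<oplus>\<^bsub>sec Cn U\<^esub> N U s" .
    fix t assume t: "t \<in> carrier (sec Cn U)"
    show "D U (s \<otimes>\<^bsub>sec Cn U\<^esub> t) = s \<otimes>\<^bsub>sec Cn U\<^esub> D U t \<oplus>\<^bsub>sec Cn U\<^esub> t \<otimes>\<^bsub>sec Cn U\<^esub> D U s"
      using s t N.ln_derivation[OF N_mult[OF U] s t] by (simp add: D \<Lambda>_def)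
  qed
  have D_ideal: "D U s \<in> P k U" if U: "U \<in> opens Cn" and s: "s \<in> carrier (sec Cn U)"
      and N: "\<And>j. (N U ^^ Suc j) s \<in> P k U" for U s k
  proof -
    interpret N: nilpotent_op "sec Cn U" "scal Cn U" "N U" n by (rule N_nilpotent[OF U])
    have "\<Lambda> U s \<in> P k U"
      unfolding \<Lambda>_def
    proof (rule N.ev_mem_ideal[OF ideal_power_ideal[OF U] s])
      fix j assume "fps_nth (fps_ln 1 :: complex fps) j \<noteq> 0"
      then show "(N U ^^ j) s \<in> P k U"
        using N[of "j - 1"] by (cases j) auto
    qed
    with U s show ?thesis by (simp add: D_def)
  qed
  interpret N: ideal_raising Cn \<I> N "\<lambda>U. \<one>\<^bsub>sec Cn U\<^esub>" by (rule N_raising)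
  have opens_eq: "{V \<in> opens Cn. V \<subseteq> points Cn} = opens Cn"
    by (auto dest: openin_subset)
  have D_in: "D \<in> ideal_derivations C Cn \<pi> (points Cn)"
    unfolding ideal_derivations_def derivations_def opens_eq
  proof (intro CollectI conjI ballI impI allI)
    show "D \<in> extensional (opens Cn)" by (simp add: D_def)
  next
    fix U assume U: "U \<in> opens Cn"
    interpret D: nilpotent_op "sec Cn U" "scal Cn U" "D U" n by (rule sec_D(1)[OF U])
    show "D U \<in> carrier (sec Cn U) \<rightarrow>\<^sub>E carrier (sec Cn U)"
      using U D.T_closed by (auto simp: PiE_iff) (simp add: D_def)
    show "D U ` carrier (sec Cn U) \<subseteq> \<I> U"
    proof clarify
      fix s assume s: "s \<in> carrier (sec Cn U)"
      have "D U s \<in> P 0 U"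
      proof (rule D_ideal[OF U s])
        fix j show "(N U ^^ Suc j) s \<in> P 0 U"
          using N.T_iterate[OF U s, of j] ideal_power_antimono[OF U, of 0 j] by auto
      qed
      then show "D U s \<in> \<I> U" by simp
    qed
    show "D U ` \<I> U \<subseteq> curve_ideal_square C Cn \<pi> U"
    proof clarify
      fix s assume s: "s \<in> \<I> U"
      have "D U s \<in> P 1 U"
      proof (rule D_ideal[OF U])
        fix j show "(N U ^^ Suc j) s \<in> P 1 U"
          using N.T_iterate_ideal[OF U s, of "Suc j"] ideal_power_antimono[OF U, of 1 "Suc j"] by auto
      qed (use s in \<open>simp add: mem_curve_ideal\<close>)
      then show "D U s \<in> curve_ideal_square C Cn \<pi> U" by (simp add: curve_ideal_square_def)
    qed
    fix s assume s: "s \<in> carrier (sec Cn U)"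
    show "D U (scal Cn U c \<otimes>\<^bsub>sec Cn U\<^esub> s) = scal Cn U c \<otimes>\<^bsub>sec Cn U\<^esub> D U s" for c
      by (rule D.T_scale[OF s])
    fix t assume t: "t \<in> carrier (sec Cn U)"
    show "D U (s \<oplus>\<^bsub>sec Cn U\<^esub> t) = D U s \<oplus>\<^bsub>sec Cn U\<^esub> D U t"
      by (rule D.T_add[OF s t])
    show "D U (s \<otimes>\<^bsub>sec Cn U\<^esub> t) = s \<otimes>\<^bsub>sec Cn U\<^esub> D U t \<oplus>\<^bsub>sec Cn U\<^esub> t \<otimes>\<^bsub>sec Cn U\<^esub> D U s"
      by (rule sec_D(3)[OF U s t])
  next
    fix U V s assume U: "U \<in> opens Cn" and V: "V \<in> opens Cn" and VU: "V \<subseteq> U \<and> U \<subseteq> points Cn"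
      and s: "s \<in> carrier (sec Cn U)"
    interpret N: nilpotent_op "sec Cn U" "scal Cn U" "N U" n by (rule N_nilpotent[OF U])
    interpret r: ring_hom_cring "sec Cn U" "sec Cn V" "res Cn U V"
      by (rule res_ring_hom) (use U V VU in auto)
    have "res Cn U V (\<Lambda> U s) = \<Lambda> V (res Cn U V s)"
      unfolding \<Lambda>_def
      by (rule N.ev_hom[OF complex_algebra_sec[OF V] r.homh _ _ s])
        (use U V VU res_scal N.T_res in auto)
    then show "D V (res Cn U V s) = res Cn U V (D U s)"
      using U V s by (simp add: D_def)
  qed
  have unique: "E = D" if E: "E \<in> ideal_derivations C Cn \<pi> (points Cn)" "mor_eq Cn Cn \<phi> (chi Cn E)" for E
  proof -
    have E': "E \<in> derivations Cn (points Cn)"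
      using E(1) by (simp add: ideal_derivations_def)
    have E_ideal: "E U ` carrier (sec Cn U) \<subseteq> \<I> U"
        "E U ` \<I> U \<subseteq> curve_ideal_square C Cn \<pi> U" if "U \<in> opens Cn" for U
      using E(1) that openin_subset[of "top_of Cn" U] by (simp_all add: ideal_derivations_def)
    have E_ext: "E \<in> extensional (opens Cn)"
      and E_fun: "\<And>U. U \<in> opens Cn \<Longrightarrow> E U \<in> carrier (sec Cn U) \<rightarrow>\<^sub>E carrier (sec Cn U)"
      using E' openin_subset unfolding derivations_def opens_eq by blast+
    have E_add: "E U (s \<oplus>\<^bsub>sec Cn U\<^esub> t) = E U s \<oplus>\<^bsub>sec Cn U\<^esub> E U t"
      and E_mult: "E U (s \<otimes>\<^bsub>sec Cn U\<^esub> t) = s \<otimes>\<^bsub>sec Cn U\<^esub> E U t \<oplus>\<^bsub>sec Cn U\<^esub> t \<otimes>\<^bsub>sec Cn U\<^esub> E U s"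
      and E_scale: "E U (scal Cn U c \<otimes>\<^bsub>sec Cn U\<^esub> s) = scal Cn U c \<otimes>\<^bsub>sec Cn U\<^esub> E U s"
      if "U \<in> opens Cn" "s \<in> carrier (sec Cn U)" "t \<in> carrier (sec Cn U)" for U s t c
      using E' that openin_subset[of "top_of Cn" U] by (simp_all add: derivations_def)
    have E_res: "E V (res Cn U V s) = res Cn U V (E U s)"
      if "U \<in> opens Cn" "V \<in> opens Cn" "V \<subseteq> U" "s \<in> carrier (sec Cn U)" for U V s
      using E' that openin_subset[of "top_of Cn" U] by (simp add: derivations_def)
    have "ideal_raising Cn \<I> E (\<lambda>U. \<zero>\<^bsub>sec Cn U\<^esub>)"
    proof unfold_locales
      fix U assume U: "U \<in> opens Cn"
      interpret cring "sec Cn U" by (rule cring_sec[OF U])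
      show "\<zero>\<^bsub>sec Cn U\<^esub> \<in> carrier (sec Cn U)" by simp
      show "E U s \<in> P 1 U" if "s \<in> \<I> U" for s
        using E_ideal(2)[OF U] that by (auto simp: curve_ideal_square_def)
      fix s assume s: "s \<in> carrier (sec Cn U)"
      show "E U s \<in> \<I> U" using E_ideal(1)[OF U] s by auto
      fix t assume t: "t \<in> carrier (sec Cn U)"
      show "E U (s \<oplus>\<^bsub>sec Cn U\<^esub> t) = E U s \<oplus>\<^bsub>sec Cn U\<^esub> E U t"
        by (rule E_add[OF U s t])
      have "E U s \<in> carrier (sec Cn U)" "E U t \<in> carrier (sec Cn U)"
        using E_fun[OF U] s t by auto
      then show "E U (s \<otimes>\<^bsub>sec Cn U\<^esub> t) = s \<otimes>\<^bsub>sec Cn U\<^esub> E U t \<oplus>\<^bsub>sec Cn U\<^esub> t \<otimes>\<^bsub>sec Cn U\<^esub> E U s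
          \<oplus>\<^bsub>sec Cn U\<^esub> \<zero>\<^bsub>sec Cn U\<^esub> \<otimes>\<^bsub>sec Cn U\<^esub> (E U s \<otimes>\<^bsub>sec Cn U\<^esub> E U t)"
        using s t by (simp add: E_mult[OF U s t])
    qed (rule E_res)
    then have E_nilpotent: "nilpotent_op (sec Cn U) (scal Cn U) (E U) n" if "U \<in> opens Cn" for U
      using E_scale that by (intro nilpotent_op_if_ideal_raising) auto
    have "E U s = D U s" if U: "U \<in> opens Cn" and s: "s \<in> carrier (sec Cn U)" for U s
    proof -
      interpret E: nilpotent_op "sec Cn U" "scal Cn U" "E U" n by (rule E_nilpotent[OF U])
      have "\<Lambda> U s = E U s"
        unfolding \<Lambda>_def
        using exp_iff[OF E_nilpotent] E(2) U N_closed s by (intro E.ln_exp) auto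
      with U s show ?thesis by (simp add: D_def)
    qed
    then have "E U = D U" if "U \<in> opens Cn" for U
      using E_fun[OF that] that by (intro extensionalityI[of _ "carrier (sec Cn U)"]) (auto simp: D_def PiE_iff)
    then show "E = D"
      using E_ext by (intro extensionalityI[of _ "opens Cn"]) (auto simp: D_def)
  qed
  show ?thesis
  proof (rule ex1I[of _ D])
    show "D \<in> ideal_derivations C Cn \<pi> (points Cn) \<and> mor_eq Cn Cn \<phi> (chi Cn D)"
      using D_in exp_iff[OF sec_D(1)] sec_D(2) by blast
  qed (use unique in blast)
qed

end
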